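(* Consider the switched descriptor system $E_{\sigma(t)}\dot x=A_{\sigma(t)}x$, $\sigma(t)\in\{1,2\}$, with $E_i,A_i\in\mathbb{R}^{n\times n}$, $A_1,A_2$ nonsingular. For $i=1,2$ let $(X_i,Y_i)$ be a full rank decomposition of $E_i$ with $X_i,Y_i\in\mathbb{R}^{n\times r}$ (so $\mathrm{rank}\,E_1=\mathrm{rank}\,E_2=r$), and set $\tilde E_i=Y_i^TA_i^{-1}X_i\in\mathbb{R}^{r\times r}$. Assume that for every solution, $Y_j^Tx(t_*^+)=Y_i^Tx(t_*^-)$ whenever $\sigma$ switches from $i$ to $j$ at $t_*$. Suppose: (a) $(E_1,A_1)$ and $(E_2,A_2)$ are stable; (b) $(E_1,A_1)$ has index one and $(E_2,A_2)$ has index two; (c) there exist vectors $g,h\in\mathbb{R}^r$ with $\tilde E_2=\tilde E_1-gh^T$, where $(\tilde E_1,g)$ is controllable and $(\tilde E_1,h)$ is observable (i.e. $(h^T,\tilde E_1)$ is an observable pair); (d) $\tilde E_1\tilde E_2$ has no negative real eigenvalues and exactly one zero eigenvalue. Then the switched system is GUES.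
   Context: For $E,A\in\mathbb{R}^{n\times n}$ with $A$ nonsingular, $(E,A)$ denotes the descriptor system $E\dot x=Ax$. It is stable if every root $s$ of $\det(sE-A)=0$ has negative real part. Its index is the smallest integer $k^*\ge0$ with $\mathrm{Im}((A^{-1}E)^{k^*+1})=\mathrm{Im}((A^{-1}E)^{k^*})$, and its consistency space is $\mathcal{C}(E,A)=\mathrm{Im}((A^{-1}E)^{k^*})$. A full rank decomposition of $E$ is a pair $(X,Y)$ of matrices with full column rank such that $E=XY^T$. Switched descriptor system: the switching signal $\sigma$ is piecewise constant with finitely many discontinuities in every bounded interval; a solution $x(\cdot)$ is differentiable and satisfies $E_{\sigma(t)}\dot x(t)=A_{\sigma(t)}x(t)$ at every $t$ where $\sigma$ is continuous, with one-sided limits $x(t_*^\pm)$ at discontinuities of $\sigma$ (the equation is not required there). The system is GUES if there exist $\beta,\alpha>0$ such that every solution satisfies $\|x(t)\|\le\beta e^{-\alpha(t-t_0)}\|x(t_0)\|$ for all $t\ge t_0$. *)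

theory Defs
  imports "HOL-Analysis.Analysis" "HOL-Computational_Algebra.Polynomial"
begin

text \<open>Matrix power with respect to the matrix product (note: the power
  operation of the vec type is componentwise, hence this separate definition).\<close>
definition matpow :: "'a::comm_ring_1^'n^'n \<Rightarrow> nat \<Rightarrow> 'a^'n^'n" where
  "matpow M k = (((**) M) ^^ k) (mat 1)"

text \<open>Image (column space) of a real matrix.\<close>
definition mat_image :: "real^'n^'m \<Rightarrow> (real^'m) set" where
  "mat_image M = range (\<lambda>v. M *v v)"

text \<open>Index of the descriptor system (E,A), A nonsingular.\<close>
definition desc_index :: "real^'n^'n \<Rightarrow> real^'n^'n \<Rightarrow> nat" where
  "desc_index E A =
     (LEAST k. mat_image (matpow (matrix_inv A ** E) (Suc k)) = mat_image (matpow (matrix_inv A ** E) k))"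

text \<open>Stability: every (complex) root s of det(sE - A) = 0 has negative real part.\<close>
definition desc_stable :: "real^'n^'n \<Rightarrow> real^'n^'n \<Rightarrow> bool" where
  "desc_stable E A \<longleftrightarrow>
     (\<forall>s::complex. det (\<chi> i j. s * complex_of_real (E$i$j) - complex_of_real (A$i$j)) = 0 \<longrightarrow> Re s < 0)"

text \<open>Full rank decomposition E = X Y^T with X, Y of full column rank.\<close>
definition full_rank_decomp :: "real^'n^'n \<Rightarrow> real^'r^'n \<Rightarrow> real^'r^'n \<Rightarrow> bool" where
  "full_rank_decomp E X Y \<longleftrightarrow> rank X = CARD('r) \<and> rank Y = CARD('r) \<and> E = X ** transpose Y"

text \<open>Controllability of the pair (M, g): the Krylov vectors M^k g, k < r, span R^r
  (Kalman rank condition).\<close>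
definition controllable :: "real^'r^'r \<Rightarrow> real^'r \<Rightarrow> bool" where
  "controllable M g \<longleftrightarrow> span {matpow M k *v g | k. k < CARD('r)} = UNIV"

text \<open>Observability of the pair (h^T, M): the only vector v with h^T M^k v = 0
  for all k < r is v = 0 (Kalman rank condition on the observability matrix).\<close>
definition observable :: "real^'r \<Rightarrow> real^'r^'r \<Rightarrow> bool" where
  "observable h M \<longleftrightarrow> (\<forall>v. (\<forall>k < CARD('r). h \<bullet> (matpow M k *v v) = 0) \<longrightarrow> v = 0)"

text \<open>Characteristic polynomial det(sI - M).\<close>
definition char_poly :: "real^'r^'r \<Rightarrow> real poly" where
  "char_poly M = det (\<chi> i j. (if i = j then [:0, 1:] else 0) - [:M$i$j:])"

text \<open>Outer product g h^T.\<close>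
definition outer :: "real^'r \<Rightarrow> real^'r \<Rightarrow> real^'r^'r" where
  "outer g h = (\<chi> i j. g$i * h$j)"

text \<open>Switching signals with values in {1,2}: finitely many discontinuities in every
  bounded interval (hence piecewise constant).\<close>
definition switching_signal :: "(real \<Rightarrow> nat) \<Rightarrow> bool" where
  "switching_signal \<sigma> \<longleftrightarrow> (\<forall>t. \<sigma> t \<in> {1, 2}) \<and>
     (\<forall>a b. finite {t \<in> {a..b}. \<not> isCont \<sigma> t})"

text \<open>Solution on [t0, \<infinity>) of the switched descriptor system with jump rule
  Y_j^T x(t+) = Y_i^T x(t-) at a switch from i to j.  Convention: x is right-continuous
  at the switching instants and at t0 (x(t) = x(t+)).\<close>
definition switched_solution ::
  "(nat \<Rightarrow> real^'n^'n) \<Rightarrow> (nat \<Rightarrow> real^'n^'n) \<Rightarrow> (nat \<Rightarrow> real^'r^'n)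
    \<Rightarrow> (real \<Rightarrow> nat) \<Rightarrow> real \<Rightarrow> (real \<Rightarrow> real^'n) \<Rightarrow> bool" where
  "switched_solution E A Y \<sigma> t0 x \<longleftrightarrow>
     (x \<longlongrightarrow> x t0) (at_right t0) \<and>
     (\<forall>t > t0. isCont \<sigma> t \<longrightarrow>
        (\<exists>v. (x has_vector_derivative v) (at t) \<and> E (\<sigma> t) *v v = A (\<sigma> t) *v x t)) \<and>
     (\<forall>t > t0. \<not> isCont \<sigma> t \<longrightarrow>
        (\<exists>xm xp i j. (x \<longlongrightarrow> xm) (at_left t) \<and> (x \<longlongrightarrow> xp) (at_right t) \<and>
           (\<sigma> \<longlongrightarrow> i) (at_left t) \<and> (\<sigma> \<longlongrightarrow> j) (at_right t) \<and>
           x t = xp \<and> transpose (Y j) *v xp = transpose (Y i) *v xm))"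

text \<open>Global uniform exponential stability.\<close>
definition GUES ::
  "(nat \<Rightarrow> real^'n^'n) \<Rightarrow> (nat \<Rightarrow> real^'n^'n) \<Rightarrow> (nat \<Rightarrow> real^'r^'n) \<Rightarrow> bool" where
  "GUES E A Y \<longleftrightarrow> (\<exists>\<beta> > 0. \<exists>\<alpha> > 0. \<forall>\<sigma> t0 x.
     switching_signal \<sigma> \<and> switched_solution E A Y \<sigma> t0 x \<longrightarrow>
       (\<forall>t \<ge> t0. norm (x t) \<le> \<beta> * exp (- \<alpha> * (t - t0)) * norm (x t0)))"

end

theory Submission
  imports Defs
    "HOL-Computational_Algebra.Fundamental_Theorem_Algebra"
    "HOL-Computational_Algebra.Polynomial_Factorial"
    "HOL-Computational_Algebra.Field_as_Ring"
begin

text \<open>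
  The variable \<open>y = Y\<^sub>i\<^sup>T x\<close> is continuous across switches and satisfies \<open>y = Et\<^sub>i y'\<close>,
  while \<open>x = A\<^sub>i\<^sup>-\<^sup>1 X\<^sub>i y'\<close>; index one makes \<open>A = Et\<^sub>1\<close> nonsingular, index two makes the kernel and
  the image of \<open>B = Et\<^sub>2 = A - g h\<^sup>T\<close> intersect trivially. It therefore suffices to find \<open>P > 0\<close> with
  \<open>A\<^sup>T P + P A < 0\<close> and \<open>B\<^sup>T P + P B\<close> negative off the kernel of \<open>B\<close>.
  As in the Kalman-Yakubovich-Popov lemma one looks for a vector \<open>q\<close> with
  \<open>A\<^sup>T P + P A = - q q\<^sup>T - \<epsilon> B\<^sup>T B\<close> and \<open>P g = h - \<surd>2 q\<close>, because then
  \<open>B\<^sup>T P + P B = - (q - \<surd>2 h) (q - \<surd>2 h)\<^sup>T - \<epsilon> B\<^sup>T B\<close>.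
  With \<open>a\<close> the characteristic polynomial of \<open>A\<close> and \<open>H(s) = h\<^sup>T (s I - A)\<^sup>-\<^sup>1 g\<close>, the vector \<open>q\<close> comes
  from a spectral factorization of \<open>2 |a|\<^sup>2 (1 + Re H)\<close>, lowered by an \<open>\<epsilon>\<close>-term, on the imaginary axis.
  By the matrix determinant lemma this function equals \<open>\<plusminus>2 det (s\<^sup>2 I - A B)\<close>, so the eigenvalue condition
  on \<open>A B\<close> says that it is positive for \<open>s = i\<omega>\<close>, \<open>\<omega> \<noteq> 0\<close>, and has a zero of order exactly two at
  \<open>s = 0\<close>; the \<open>\<epsilon>\<close>-term vanishes there to the same order and so can be subtracted.
\<close>

section \<open>Real polynomials and their complex roots\<close>

definition cpoly :: "real poly \<Rightarrow> complex \<Rightarrow> complex" where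
  "cpoly p z = poly (map_poly of_real p) z"

lemma cpoly_0 [simp]: "cpoly 0 z = 0"
  by (simp add: cpoly_def)

lemma cpoly_pCons [simp]: "cpoly (pCons c p) z = of_real c + z * cpoly p z"
  by (simp add: cpoly_def map_poly_pCons)

lemma cpoly_add [simp]: "cpoly (p + q) z = cpoly p z + cpoly q z"
  by (induction p q rule: poly_induct2) (simp_all add: algebra_simps)

lemma cpoly_smult [simp]: "cpoly (smult c p) z = of_real c * cpoly p z"
  by (induction p) (simp_all add: algebra_simps)

lemma cpoly_uminus [simp]: "cpoly (- p) z = - cpoly p z"
  using cpoly_smult[of "-1" p z] by simp

lemma cpoly_mult [simp]: "cpoly (p * q) z = cpoly p z * cpoly q z"
  by (induction p) (simp_all add: algebra_simps)

lemma cpoly_root_exists: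
  assumes "degree p > 0"
  shows "\<exists>z. cpoly p z = 0"
proof -
  have "degree (map_poly complex_of_real p) = degree p"
    by (rule degree_map_poly) simp
  hence "\<not> constant (poly (map_poly complex_of_real p))"
    using assms by (simp add: constant_degree)
  thus ?thesis
    unfolding cpoly_def by (rule fundamental_theorem_of_algebra)
qed

definition real_min_poly :: "complex \<Rightarrow> real poly" where
  "real_min_poly z = (if Im z = 0 then [:- Re z, 1:] else [:(Re z)\<^sup>2 + (Im z)\<^sup>2, - 2 * Re z, 1:])"

lemma degree_real_min_poly: "degree (real_min_poly z) = (if Im z = 0 then 1 else 2)"
  by (simp add: real_min_poly_def)

lemma real_min_poly_nonzero [simp]: "real_min_poly z \<noteq> 0"
  by (simp add: real_min_poly_def)

lemma cpoly_real_min_poly: "cpoly (real_min_poly z) z = 0"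
  by (simp add: real_min_poly_def complex_eq_iff power2_eq_square algebra_simps)

lemma real_min_poly_minimal:
  assumes "cpoly p z = 0" "degree p < degree (real_min_poly z)"
  shows "p = 0"
proof (cases "Im z = 0")
  case True
  hence "degree p = 0" using assms(2) by (simp add: degree_real_min_poly)
  then obtain c where "p = [:c:]" using degree_eq_zeroE by blast
  thus ?thesis using assms(1) by simp
next
  case False
  hence "degree p \<le> 1" using assms(2) by (simp add: degree_real_min_poly)
  hence p: "p = [:coeff p 0, coeff p 1:]"
    by (intro poly_eqI) (auto simp: coeff_pCons coeff_eq_0 split: nat.splits)
  have "of_real (coeff p 0) + z * of_real (coeff p 1) = 0"
    using assms(1) by (subst (asm) p) simp
  hence "coeff p 0 + Re z * coeff p 1 = 0" "Im z * coeff p 1 = 0"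
    by (simp_all add: complex_eq_iff)
  thus ?thesis using False p by simp
qed

lemma real_min_poly_dvd_iff: "real_min_poly z dvd p \<longleftrightarrow> cpoly p z = 0"
proof
  assume "real_min_poly z dvd p"
  thus "cpoly p z = 0" by (auto simp: cpoly_real_min_poly elim!: dvdE)
next
  assume root: "cpoly p z = 0"
  have "p = real_min_poly z * (p div real_min_poly z) + p mod real_min_poly z"
    by simp
  hence "cpoly (p mod real_min_poly z) z = 0"
    using root cpoly_real_min_poly by (metis add_0 cpoly_add cpoly_mult mult_zero_left)
  moreover have "p mod real_min_poly z = 0 \<or> degree (p mod real_min_poly z) < degree (real_min_poly z)"
    by (rule degree_mod_less) simp
  ultimately have "p mod real_min_poly z = 0"
    using real_min_poly_minimal by blast
  thus "real_min_poly z dvd p" by (rule mod_0_imp_dvd)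
qed

lemma real_poly_induct [consumes 1, case_names const factor]:
  assumes "p \<noteq> 0"
    and const: "\<And>c. c \<noteq> 0 \<Longrightarrow> Q [:c:]"
    and factor: "\<And>z p. p \<noteq> 0 \<Longrightarrow> Q p \<Longrightarrow> Q (real_min_poly z * p)"
  shows "Q p"
  using assms(1)
proof (induction "degree p" arbitrary: p rule: less_induct)
  case less
  show ?case
  proof (cases "degree p = 0")
    case True
    then obtain c where "p = [:c:]" using degree_eq_zeroE by blast
    thus ?thesis using const less.prems by simp
  next
    case False
    then obtain z where "cpoly p z = 0" using cpoly_root_exists by blast
    then obtain q where q: "p = real_min_poly z * q"
      using real_min_poly_dvd_iff by (auto simp: dvd_def)
    hence "q \<noteq> 0" using less.prems by auto
    moreover from this have "degree q < degree p"
      by (simp add: q degree_mult_eq degree_real_min_poly)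
    ultimately show ?thesis using less.hyps factor q by blast
  qed
qed

lemma real_coprime_if_no_common_root:
  fixes p q :: "real poly"
  assumes "p \<noteq> 0" and no_root: "\<And>z. cpoly p z = 0 \<Longrightarrow> cpoly q z \<noteq> 0"
  shows "coprime p q"
proof -
  have "degree (gcd p q) = 0"
  proof (rule ccontr)
    assume "degree (gcd p q) \<noteq> 0"
    then obtain z where "cpoly (gcd p q) z = 0" using cpoly_root_exists by blast
    hence "real_min_poly z dvd p" "real_min_poly z dvd q"
      unfolding real_min_poly_dvd_iff[symmetric] by (auto dest: dvd_trans)
    thus False using no_root by (auto simp: real_min_poly_dvd_iff)
  qed
  hence "is_unit (gcd p q)" using assms(1) is_unit_iff_degree[of "gcd p q"] by simp
  thus ?thesis by (simp only: is_unit_gcd)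
qed

lemma poly_eqI_infinite:
  fixes p q :: "'a::idom poly"
  assumes "infinite S" "\<And>x. x \<in> S \<Longrightarrow> poly p x = poly q x"
  shows "p = q"
proof (rule ccontr)
  assume "p \<noteq> q"
  hence "finite {x. poly (p - q) x = 0}" by (intro poly_roots_finite) simp
  moreover have "S \<subseteq> {x. poly (p - q) x = 0}" using assms(2) by auto
  ultimately show False using assms(1) finite_subset by blast
qed

section \<open>Even polynomials and spectral factorization\<close>

abbreviation poly_refl :: "'a::comm_ring_1 poly \<Rightarrow> 'a poly" where
  "poly_refl p \<equiv> pcompose p [:0, -1:]"

abbreviation poly_negsq :: "'a::comm_ring_1 poly \<Rightarrow> 'a poly" where
  "poly_negsq p \<equiv> pcompose p [:0, 0, -1:]"

lemma cpoly_poly_refl: "cpoly (poly_refl p) z = cpoly p (- z)"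
  by (induction p) (simp_all add: pcompose_pCons)

lemma degree_poly_refl [simp]: "degree (poly_refl p) = degree p"
  for p :: "'a::idom poly"
  by (simp add: degree_pcompose)

lemma
  fixes p :: "'a::idom poly"
  shows degree_mult_poly_refl: "degree (p * poly_refl p) = 2 * degree p"
    and lead_coeff_mult_poly_refl: "lead_coeff (p * poly_refl p) = (-1) ^ degree p * (lead_coeff p)\<^sup>2"
proof -
  have "poly_refl p = 0 \<longleftrightarrow> p = 0" by (rule pcompose_eq_0_iff) simp
  thus "degree (p * poly_refl p) = 2 * degree p"
    by (cases "p = 0") (simp_all add: degree_mult_eq)
  show "lead_coeff (p * poly_refl p) = (-1) ^ degree p * (lead_coeff p)\<^sup>2"
    unfolding lead_coeff_mult by (subst lead_coeff_comp) (simp_all add: power2_eq_square mult_ac)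
qed

lemma degree_sum_mult_poly_refl_le:
  fixes p :: "'i \<Rightarrow> 'a::idom poly"
  assumes "finite I" "\<And>i. i \<in> I \<Longrightarrow> degree (p i) \<le> n"
  shows "degree (\<Sum>i\<in>I. p i * poly_refl (p i)) \<le> 2 * n"
  using assms by (intro degree_sum_le) (simp_all add: degree_mult_poly_refl)

lemma even_poly_is_negsq:
  fixes R :: "'a::{idom, ring_char_0} poly"
  assumes "poly_refl R = R"
  shows "\<exists>\<rho>. R = poly_negsq \<rho>"
  using assms
proof (induction "degree R" arbitrary: R rule: less_induct)
  case less
  show ?case
  proof (cases "degree R = 0")
    case True
    then obtain c where "R = [:c:]" using degree_eq_zeroE by blast
    hence "R = poly_negsq [:c:]" by simp
    thus ?thesis by blast
  next
    case False
    obtain c d R' where R_pCons: "R = pCons c (pCons d R')" by (metis pCons_cases)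
    have coeffs: "(-1) ^ i * coeff R i = coeff R i" for i
      using less.prems coeff_pcompose_linear[of R "-1" i] by simp
    have "d = 0" using coeffs[of 1] by (simp add: R_pCons)
    hence R: "R = pCons c (pCons 0 R')" using R_pCons by simp
    have "poly_refl R' = R'"
      using coeffs[of "Suc (Suc i)" for i] by (intro poly_eqI) (simp add: coeff_pcompose_linear R)
    moreover have "degree R' < degree R" using False by (auto simp: R)
    ultimately obtain \<rho> where "R' = poly_negsq \<rho>" using less.hyps by blast
    hence "R = poly_negsq (pCons c (- \<rho>))"
      by (simp add: R pcompose_pCons pcompose_uminus)
    thus ?thesis by blast
  qed
qed

lemma poly_real_min_poly_pos:
  assumes "Im z = 0 \<Longrightarrow> Re z < 0" "x \<ge> 0"
  shows "poly (real_min_poly z) x > 0"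
proof (cases "Im z = 0")
  case True
  thus ?thesis using assms by (simp add: real_min_poly_def)
next
  case False
  have "poly (real_min_poly z) x = (x - Re z)\<^sup>2 + (Im z)\<^sup>2"
    using False by (simp add: real_min_poly_def algebra_simps power2_eq_square)
  thus ?thesis using False by (simp add: add_nonneg_pos)
qed

lemma spectral_factor_real_min_poly:
  assumes "Im z = 0 \<Longrightarrow> Re z < 0"
  shows "\<exists>d. d * poly_refl d = poly_negsq (real_min_poly z) \<and> lead_coeff d > 0"
proof (cases "Im z = 0")
  case True
  define d where "d = [:sqrt (- Re z), 1:]"
  have "sqrt (- Re z) * sqrt (- Re z) = - Re z"
    using assms True by simp
  hence "d * poly_refl d = poly_negsq (real_min_poly z)"
    using True by (simp add: d_def real_min_poly_def pcompose_pCons)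
  thus ?thesis by (intro exI[of _ d]) (simp add: d_def)
next
  case False
  define \<beta> where "\<beta> = cmod z"
  define \<alpha> where "\<alpha> = sqrt (2 * (\<beta> - Re z))"
  have \<beta>: "\<beta> * \<beta> = (Re z)\<^sup>2 + (Im z)\<^sup>2"
    by (simp add: \<beta>_def cmod_power2 flip: power2_eq_square)
  have \<alpha>: "\<alpha> * \<alpha> = 2 * (\<beta> - Re z)"
    using complex_Re_le_cmod[of z] by (simp add: \<alpha>_def \<beta>_def)
  define d where "d = [:\<beta>, \<alpha>, 1:]"
  have "d * poly_refl d = [:\<beta> * \<beta>, 0, 2 * \<beta> - \<alpha> * \<alpha>, 0, 1:]"
    by (simp add: d_def pcompose_pCons)
  also have "\<dots> = poly_negsq (real_min_poly z)"
    unfolding \<alpha> \<beta> using False by (simp add: real_min_poly_def pcompose_pCons)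
  finally show ?thesis by (intro exI[of _ d]) (simp add: d_def)
qed

lemma spectral_factor:
  fixes \<rho> :: "real poly"
  assumes "\<And>x. x \<ge> 0 \<Longrightarrow> poly \<rho> x > 0"
  shows "\<exists>d. d * poly_refl d = poly_negsq \<rho> \<and> lead_coeff d > 0"
proof -
  have "\<rho> \<noteq> 0" using assms[of 0] by auto
  thus ?thesis using assms
  proof (induction rule: real_poly_induct)
    case (const c)
    hence "c > 0" using const.prems[of 0] by simp
    thus ?case by (intro exI[of _ "[:sqrt c:]"]) simp
  next
    case (factor z p)
    have z: "Re z < 0" if "Im z = 0"
    proof (rule ccontr)
      assume "\<not> Re z < 0"
      thus False using factor.prems[of "Re z"] that by (simp add: real_min_poly_def)
    qed
    have "poly p x > 0" if "x \<ge> 0" for x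
      using factor.prems[OF that] poly_real_min_poly_pos[OF z that] by (simp add: zero_less_mult_iff)
    then obtain e where e: "e * poly_refl e = poly_negsq p" "lead_coeff e > 0"
      using factor.IH by blast
    obtain d where d: "d * poly_refl d = poly_negsq (real_min_poly z)" "lead_coeff d > 0"
      using spectral_factor_real_min_poly[OF z] by blast
    have "(d * e) * poly_refl (d * e) = (d * poly_refl d) * (e * poly_refl e)"
      unfolding pcompose_mult by (simp only: mult_ac)
    also have "\<dots> = poly_negsq (real_min_poly z * p)"
      unfolding d e pcompose_mult ..
    finally show ?case
      using d(2) e(2) by (intro exI[of _ "d * e"]) (simp add: lead_coeff_mult)
  qed
qed

lemma poly_pos_if_no_root_ge:
  fixes p :: "real poly"
  assumes lead: "lead_coeff p > 0" and no_root: "\<And>x. x \<ge> a \<Longrightarrow> poly p x \<noteq> 0" and "x \<ge> a"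
  shows "poly p x > 0"
proof (rule ccontr)
  assume "\<not> poly p x > 0"
  hence "poly p x < 0" using no_root[OF \<open>x \<ge> a\<close>] by simp
  moreover obtain N where "\<And>y. y \<ge> N \<Longrightarrow> poly p y \<ge> lead_coeff p"
    using poly_pinfty_gt_lc[OF lead] by blast
  hence "poly p (max N (x + 1)) > 0"
    using lead by (metis max.cobounded1 less_le_trans)
  moreover have "x < max N (x + 1)" by simp
  ultimately obtain y where "x < y" "poly p y = 0"
    using poly_IVT_pos[of x "max N (x + 1)" p] by blast
  thus False using no_root[of y] \<open>x \<ge> a\<close> by simp
qed

lemma lead_coeff_pos_if_poly_pos:
  fixes p :: "real poly"
  assumes "\<And>x. x \<ge> a \<Longrightarrow> poly p x > 0"
  shows "lead_coeff p > 0"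
proof (rule ccontr)
  assume "\<not> lead_coeff p > 0"
  moreover have "p \<noteq> 0" using assms[of a] by auto
  ultimately have lead: "lead_coeff (- p) > 0"
    by (simp add: lead_coeff_minus less_le)
  then obtain N where N: "\<And>x. x \<ge> N \<Longrightarrow> poly (- p) x \<ge> lead_coeff (- p)"
    using poly_pinfty_gt_lc by blast
  have "poly (- p) (max a N) > 0"
    using lead N[of "max a N"] by (metis max.cobounded2 less_le_trans)
  thus False using assms[of "max a N"] by simp
qed

lemma poly_perturb_pos_at_top:
  fixes p q :: "real poly"
  assumes lead: "lead_coeff p > 0" and deg: "degree q \<le> degree p"
  shows "\<exists>\<delta>>0. \<exists>N. \<forall>x\<ge>N. poly (p - smult \<delta> q) x > 0"
proof -
  define c where "c = coeff q (degree p)"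
  define \<delta> where "\<delta> = lead_coeff p / (\<bar>c\<bar> + 1)"
  have \<delta>: "\<delta> > 0" using lead by (simp add: \<delta>_def)
  have "\<delta> * c \<le> \<delta> * \<bar>c\<bar>" using \<delta> by simp
  also have "\<dots> < \<delta> * (\<bar>c\<bar> + 1)" using \<delta> by simp
  also have "\<dots> = lead_coeff p" by (simp add: \<delta>_def)
  finally have coeff: "coeff (p - smult \<delta> q) (degree p) > 0" by (simp add: c_def)
  have "degree p \<le> degree (p - smult \<delta> q)"
    by (rule le_degree) (use coeff in simp)
  moreover have "degree (p - smult \<delta> q) \<le> degree p"
    using deg by (intro degree_diff_le order.trans[OF degree_smult_le]) auto
  ultimately have "degree (p - smult \<delta> q) = degree p" by simp
  hence "lead_coeff (p - smult \<delta> q) > 0" using coeff by simp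
  thus ?thesis
    using \<delta> poly_pinfty_gt_lc[of "p - smult \<delta> q"] by (meson less_le_trans)
qed

lemma poly_perturb_pos:
  fixes p q :: "real poly"
  assumes pos: "\<And>x. x \<ge> a \<Longrightarrow> poly p x > 0" and deg: "degree q \<le> degree p"
  shows "\<exists>\<epsilon>>0. \<forall>x\<ge>a. poly (p - smult \<epsilon> q) x > 0"
proof -
  obtain \<delta> N where \<delta>: "\<delta> > 0" and N: "\<And>x. x \<ge> N \<Longrightarrow> poly (p - smult \<delta> q) x > 0"
    using poly_perturb_pos_at_top[OF lead_coeff_pos_if_poly_pos[OF pos] deg] by blast
  have "continuous_on {a..N} (\<lambda>x. poly q x / poly p x)"
    using pos by (intro continuous_intros) (auto simp: less_le)
  hence "bounded ((\<lambda>x. poly q x / poly p x) ` {a..N})"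
    by (intro compact_imp_bounded compact_continuous_image) auto
  then obtain K where K: "K > 0" "\<And>x. x \<in> {a..N} \<Longrightarrow> \<bar>poly q x / poly p x\<bar> \<le> K"
    by (auto simp: bounded_pos)
  define \<epsilon> where "\<epsilon> = min \<delta> (1 / (K + 1))"
  have "\<epsilon> * K \<le> 1 / (K + 1) * K" using K(1) by (intro mult_right_mono) (simp_all add: \<epsilon>_def)
  also have "\<dots> < 1" using K(1) by simp
  finally have \<epsilon>: "0 < \<epsilon>" "\<epsilon> \<le> \<delta>" "\<epsilon> * K < 1" using K(1) \<delta> by (simp_all add: \<epsilon>_def)
  have "poly (p - smult \<epsilon> q) x > 0" if "x \<ge> a" for x
  proof (cases "x \<le> N")
    case True
    have "poly q x \<le> K * poly p x"
      using K(2)[of x] pos[OF that] True that by (simp add: abs_le_iff field_simps)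
    hence "\<epsilon> * poly q x \<le> (\<epsilon> * K) * poly p x"
      using \<epsilon>(1) by (simp add: mult.assoc)
    also have "\<dots> < poly p x"
      using mult_strict_right_mono[OF \<epsilon>(3) pos[OF that]] by simp
    finally show ?thesis by simp
  next
    case False
    hence "(1 - \<epsilon> / \<delta>) * poly p x + \<epsilon> / \<delta> * poly (p - smult \<delta> q) x > 0"
      using \<epsilon> \<delta> pos[OF that] N[of x] by (intro add_nonneg_pos mult_nonneg_nonneg mult_pos_pos) auto
    thus ?thesis using \<delta> by (simp add: algebra_simps)
  qed
  thus ?thesis using \<epsilon>(1) by blast
qed

section \<open>Polynomials in a linear operator\<close>

definition poly_apply :: "real poly \<Rightarrow> ('a::real_vector \<Rightarrow> 'a) \<Rightarrow> 'a \<Rightarrow> 'a" where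
  "poly_apply p f x = (\<Sum>k\<le>degree p. coeff p k *\<^sub>R (f ^^ k) x)"

lemma poly_apply_0 [simp]: "poly_apply 0 f x = 0"
  by (simp add: poly_apply_def)

lemma poly_apply_eq_sum:
  assumes "degree p \<le> n"
  shows "poly_apply p f x = (\<Sum>k\<le>n. coeff p k *\<^sub>R (f ^^ k) x)"
  unfolding poly_apply_def using assms
  by (intro sum.mono_neutral_left) (auto simp: coeff_eq_0)

context
  fixes f :: "'a::real_vector \<Rightarrow> 'a"
  assumes f: "linear f"
begin

lemma poly_apply_pCons: "poly_apply (pCons c p) f x = c *\<^sub>R x + f (poly_apply p f x)"
proof -
  have "poly_apply (pCons c p) f x = (\<Sum>k\<le>Suc (degree p). coeff (pCons c p) k *\<^sub>R (f ^^ k) x)"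
    by (rule poly_apply_eq_sum) (rule degree_pCons_le)
  also have "\<dots> = c *\<^sub>R x + (\<Sum>k\<le>degree p. coeff p k *\<^sub>R f ((f ^^ k) x))"
    by (subst sum.atMost_Suc_shift) simp
  also have "(\<Sum>k\<le>degree p. coeff p k *\<^sub>R f ((f ^^ k) x)) = f (poly_apply p f x)"
    by (simp add: poly_apply_def linear_sum[OF f] linear_scale[OF f])
  finally show ?thesis .
qed

lemma poly_apply_add: "poly_apply (p + q) f x = poly_apply p f x + poly_apply q f x"
  by (induction p q rule: poly_induct2) (simp_all add: poly_apply_pCons linear_add[OF f] algebra_simps)

lemma poly_apply_smult: "poly_apply (smult c p) f x = c *\<^sub>R poly_apply p f x"
  by (induction p) (simp_all add: poly_apply_pCons linear_scale[OF f] algebra_simps)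

lemma poly_apply_uminus: "poly_apply (- p) f x = - poly_apply p f x"
  using poly_apply_smult[of "-1" p x] by simp

lemma linear_poly_apply: "linear (poly_apply p f)"
proof (rule linearI)
  show "poly_apply p f (x + y) = poly_apply p f x + poly_apply p f y" for x y
    by (induction p) (simp_all add: poly_apply_pCons linear_add[OF f] algebra_simps)
  show "poly_apply p f (c *\<^sub>R x) = c *\<^sub>R poly_apply p f x" for c x
    by (induction p) (simp_all add: poly_apply_pCons linear_scale[OF f] algebra_simps)
qed

lemma poly_apply_commute: "poly_apply p f (f x) = f (poly_apply p f x)"
  by (induction p) (simp_all add: poly_apply_pCons linear_0[OF f] linear_add[OF f] linear_scale[OF f])

lemma poly_apply_mult: "poly_apply (p * q) f x = poly_apply p f (poly_apply q f x)"
  by (induction p) (simp_all add: poly_apply_pCons poly_apply_add poly_apply_smult)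

lemma poly_apply_monom: "poly_apply (monom c k) f x = c *\<^sub>R (f ^^ k) x"
  by (induction k) (simp_all add: monom_0 monom_Suc poly_apply_pCons linear_0[OF f] linear_scale[OF f])

lemma poly_apply_real_min_poly:
  shows "Im z = 0 \<Longrightarrow> poly_apply (real_min_poly z) f x = f x - Re z *\<^sub>R x"
    and "Im z \<noteq> 0 \<Longrightarrow> poly_apply (real_min_poly z) f x
      = f (f x) - (2 * Re z) *\<^sub>R f x + ((Re z)\<^sup>2 + (Im z)\<^sup>2) *\<^sub>R x"
  by (simp_all add: real_min_poly_def poly_apply_pCons linear_0[OF f] linear_add[OF f] linear_neg[OF f]
      linear_scale[OF f] linear_diff[OF f])

lemma poly_apply_sum: "poly_apply (\<Sum>i\<in>I. p i) f x = (\<Sum>i\<in>I. poly_apply (p i) f x)"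
  by (induction I rule: infinite_finite_induct) (simp_all add: poly_apply_add)

end

lemma annihilating_poly_exists:
  fixes f :: "'a::euclidean_space \<Rightarrow> 'a"
  assumes f: "linear f"
  shows "\<exists>p. p \<noteq> 0 \<and> poly_apply p f x = 0"
proof (cases "inj_on (\<lambda>k. (f ^^ k) x) {..DIM('a)}")
  case True
  let ?V = "(\<lambda>k. (f ^^ k) x) ` {..DIM('a)}"
  have "card ?V > DIM('a)" by (simp add: card_image[OF True])
  hence "dependent ?V" by (rule dependent_biggerset)
  then obtain u k where k: "k \<le> DIM('a)" "u ((f ^^ k) x) \<noteq> 0" and u: "(\<Sum>v\<in>?V. u v *\<^sub>R v) = 0"
    by (auto simp: dependent_finite)
  define p where "p = (\<Sum>k\<le>DIM('a). monom (u ((f ^^ k) x)) k)"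
  have "coeff p k = u ((f ^^ k) x)"
    using k(1) by (simp add: p_def coeff_sum)
  hence "p \<noteq> 0" using k(2) by auto
  moreover have "poly_apply p f x = 0"
    using u by (simp add: p_def poly_apply_sum[OF f] poly_apply_monom[OF f] sum.reindex[OF True])
  ultimately show ?thesis by blast
next
  case False
  then obtain i j where ij: "i \<noteq> j" "(f ^^ i) x = (f ^^ j) x" by (auto simp: inj_on_def)
  define p :: "real poly" where "p = monom 1 i + monom (-1) j"
  have "coeff p i = 1" using ij(1) by (simp add: p_def)
  hence "p \<noteq> 0" by auto
  moreover have "poly_apply p f x = 0"
    using ij(2) by (simp add: p_def poly_apply_add[OF f] poly_apply_monom[OF f])
  ultimately show ?thesis by blast
qed

section \<open>Hurwitz matrices\<close>

definition hurwitz_mat :: "real^'r^'r \<Rightarrow> bool" where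
  "hurwitz_mat A \<longleftrightarrow> (\<forall>z v. v \<noteq> 0 \<longrightarrow> map_matrix complex_of_real A *v v = z *s v \<longrightarrow> Re z < 0)"

definition complex_vec :: "real^'r \<Rightarrow> real^'r \<Rightarrow> complex^'r" where
  "complex_vec p q = (\<chi> i. Complex (p $ i) (q $ i))"

lemma complex_vec_eq_0_iff: "complex_vec p q = 0 \<longleftrightarrow> p = 0 \<and> q = 0"
  by (auto simp: complex_vec_def vec_eq_iff complex_eq_iff)

lemma map_matrix_mult_complex_vec:
  "map_matrix complex_of_real A *v complex_vec p q = complex_vec (A *v p) (A *v q)"
  by (simp add: vec_eq_iff complex_eq_iff complex_vec_def matrix_vector_mult_def)

lemma hurwitz_mat_eigenpair:
  assumes "hurwitz_mat A" "p \<noteq> 0 \<or> q \<noteq> 0"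
    and "A *v p = Re z *\<^sub>R p - Im z *\<^sub>R q" "A *v q = Im z *\<^sub>R p + Re z *\<^sub>R q"
  shows "Re z < 0"
proof -
  have "z *s complex_vec p q = map_matrix complex_of_real A *v complex_vec p q"
    unfolding map_matrix_mult_complex_vec assms(3,4)
    by (simp add: vec_eq_iff complex_eq_iff complex_vec_def)
  thus ?thesis
    using assms(1,2) unfolding hurwitz_mat_def by (metis complex_vec_eq_0_iff)
qed

lemma hurwitz_mat_kernel_real_min_poly:
  fixes A :: "real^'r^'r"
  assumes A: "hurwitz_mat A" and z: "Re z \<ge> 0"
    and ker: "poly_apply (real_min_poly z) ((*v) A) x = 0"
  shows "x = 0"
proof (cases "Im z = 0")
  case True
  hence "A *v x = Re z *\<^sub>R x" using ker by (simp add: poly_apply_real_min_poly)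
  thus ?thesis using hurwitz_mat_eigenpair[OF A, of x 0 z] True z by fastforce
next
  case False
  define p where "p = A *v x - Re z *\<^sub>R x"
  have "A *v (A *v x) = (2 * Re z) *\<^sub>R (A *v x) - ((Re z)\<^sup>2 + (Im z)\<^sup>2) *\<^sub>R x"
    using ker False
    by (simp add: poly_apply_real_min_poly algebra_simps)
  hence "A *v p = Re z *\<^sub>R p - Im z *\<^sub>R (Im z *\<^sub>R x)"
    by (simp add: p_def matrix_vector_mult_diff_distrib matrix_vector_mult_scaleR
        vec_eq_iff power2_eq_square algebra_simps)
  moreover have "A *v (Im z *\<^sub>R x) = Im z *\<^sub>R p + Re z *\<^sub>R (Im z *\<^sub>R x)"
    by (simp add: p_def matrix_vector_mult_scaleR algebra_simps)
  ultimately have "p = 0 \<and> Im z *\<^sub>R x = 0"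
    using hurwitz_mat_eigenpair[OF A, of p "Im z *\<^sub>R x" z] z by fastforce
  thus ?thesis using False by simp
qed

lemma hurwitz_mat_kernel_trivial:
  assumes "hurwitz_mat A" "A *v x = 0"
  shows "x = 0"
  using hurwitz_mat_kernel_real_min_poly[OF assms(1), of 0 x] assms(2)
  by (simp add: poly_apply_real_min_poly)

lemma hurwitz_mat_vector_induct [consumes 1, case_names zero factor]:
  fixes A :: "real^'r^'r"
  assumes A: "hurwitz_mat A"
    and zero: "R 0"
    and factor: "\<And>z N x. Re z < 0 \<Longrightarrow> subspace N \<Longrightarrow> (\<And>y. y \<in> N \<Longrightarrow> A *v y \<in> N) \<Longrightarrow> (\<And>y. y \<in> N \<Longrightarrow> R y)
      \<Longrightarrow> poly_apply (real_min_poly z) ((*v) A) x \<in> N \<Longrightarrow> R x"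
  shows "R x"
proof -
  let ?ap = "\<lambda>p. poly_apply p ((*v) A)"
  obtain p where "p \<noteq> 0" "?ap p x = 0"
    using annihilating_poly_exists[of "(*v) A" x] by auto
  thus ?thesis
  proof (induction arbitrary: x rule: real_poly_induct)
    case (const c)
    thus ?case using zero by (simp add: poly_apply_pCons)
  next
    case (factor z p)
    have commute: "?ap (real_min_poly z) (?ap p x) = 0" "?ap p (?ap (real_min_poly z) x) = 0"
      using factor.prems by (simp_all add: mult.commute flip: poly_apply_mult)
    show ?case
    proof (cases "Re z < 0")
      case True
      thus ?thesis
      proof (rule assms(3))
        show "subspace {x. ?ap p x = 0}"
          by (rule linear_subspace_kernel) (simp add: linear_poly_apply)
      qed (use factor.IH commute in \<open>auto simp: poly_apply_commute\<close>)
    next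
      case False
      hence "?ap p x = 0"
        using hurwitz_mat_kernel_real_min_poly[OF A, of z] commute(1) by simp
      thus ?thesis by (rule factor.IH)
    qed
  qed
qed

section \<open>The Lyapunov equation\<close>

definition pos_def :: "real^'r^'r \<Rightarrow> bool" where
  "pos_def P \<longleftrightarrow> transpose P = P \<and> (\<forall>x. x \<noteq> 0 \<longrightarrow> x \<bullet> (P *v x) > 0)"

definition lyapunov_op :: "real^'r^'r \<Rightarrow> real^'r^'r \<Rightarrow> real^'r^'r" where
  "lyapunov_op A P = transpose A ** P + P ** A"

declare transpose_matrix_vector [simp del]

lemma inner_transpose_mult: "x \<bullet> (transpose A *v y) = (A *v x) \<bullet> y"
  for A :: "real^'m^'n"
  by (metis dot_lmul_matrix inner_commute transpose_matrix_vector)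

lemma inner_mult_sym: "transpose P = P \<Longrightarrow> (P *v x) \<bullet> y = x \<bullet> (P *v y)"
  for P :: "real^'r^'r"
  by (metis inner_transpose_mult)

lemma uminus_matrix_vector_mult: "(- A) *v x = - (A *v x)"
  for A :: "real^'m^'n"
  by (simp add: vec_eq_iff matrix_vector_mult_def sum_negf)

lemma matrix_vector_mult_uminus: "A *v (- x) = - (A *v x)"
  for A :: "real^'m^'n"
  by (rule linear_neg) simp

lemma lyapunov_op_form:
  "x \<bullet> (lyapunov_op A P *v y) = (A *v x) \<bullet> (P *v y) + x \<bullet> (P *v (A *v y))"
  by (simp add: lyapunov_op_def matrix_vector_mult_add_rdistrib inner_add_right inner_transpose_mult
      flip: matrix_vector_mul_assoc)

lemma lyapunov_op_form_diag:
  assumes "transpose P = P"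
  shows "x \<bullet> (lyapunov_op A P *v x) = 2 * (x \<bullet> (P *v (A *v x)))"
  using inner_mult_sym[OF assms, of x "A *v x"] by (simp add: lyapunov_op_form inner_commute)

lemma linear_lyapunov_op: "linear (lyapunov_op A)"
  unfolding lyapunov_op_def
  by (intro linearI)
     (simp_all add: vec_eq_iff matrix_matrix_mult_def sum.distrib sum_distrib_left algebra_simps)

lemma transpose_lyapunov_op: "transpose (lyapunov_op A P) = lyapunov_op A (transpose P)"
  by (simp add: lyapunov_op_def transpose_def matrix_matrix_mult_def vec_eq_iff mult.commute add.commute)

lemma poly_refl_real_min_poly:
  "poly_refl (real_min_poly z) = smult (if Im z = 0 then -1 else 1) (real_min_poly (- z))"
  by (simp add: real_min_poly_def pcompose_pCons)

lemma skew_form_poly_apply: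
  fixes A :: "real^'r^'r"
  assumes skew: "\<And>x y. (A *v x) \<bullet> (P *v y) = - (x \<bullet> (P *v (A *v y)))"
  shows "poly_apply p ((*v) A) x \<bullet> (P *v y) = x \<bullet> (P *v poly_apply (poly_refl p) ((*v) A) y)"
proof (induction p arbitrary: y)
  case (pCons c p)
  have "poly_apply (pCons c p) ((*v) A) x \<bullet> (P *v y)
      = c * (x \<bullet> (P *v y)) - poly_apply p ((*v) A) x \<bullet> (P *v (A *v y))"
    by (simp add: poly_apply_pCons inner_add_left skew)
  also have "\<dots> = c * (x \<bullet> (P *v y)) - x \<bullet> (P *v (A *v poly_apply (poly_refl p) ((*v) A) y))"
    by (simp add: pCons.IH poly_apply_commute)
  also have "\<dots> = x \<bullet> (P *v poly_apply (poly_refl (pCons c p)) ((*v) A) y)"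
    by (simp add: pcompose_pCons poly_apply_pCons poly_apply_add poly_apply_uminus
        matrix_vector_mult_uminus matrix_vector_mult_diff_distrib matrix_vector_mult_scaleR
        inner_diff_right)
  finally show ?case .
qed simp

lemma lyapunov_op_kernel_trivial:
  fixes A :: "real^'r^'r"
  assumes A: "hurwitz_mat A" and zero: "lyapunov_op A P = 0"
  shows "P = 0"
proof -
  let ?ap = "\<lambda>p. poly_apply p ((*v) A)"
  have skew: "(A *v x) \<bullet> (P *v y) = - (x \<bullet> (P *v (A *v y)))" for x y
    using lyapunov_op_form[of x A P y] by (simp add: zero)
  have "\<forall>y. x \<bullet> (P *v y) = 0" for x
    using A
  proof (induction x rule: hurwitz_mat_vector_induct)
    case (factor z N x)
    have "\<forall>y. ?ap (real_min_poly (- z)) y = 0 \<longrightarrow> y = 0"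
      using hurwitz_mat_kernel_real_min_poly[OF A, of "- z"] factor.hyps(1) by simp
    hence surj: "surj (?ap (real_min_poly (- z)))"
      by (simp add: linear_poly_apply linear_injective_0 linear_injective_imp_surjective)
    show ?case
    proof
      fix y
      obtain w where w: "y = ?ap (real_min_poly (- z)) w" using surj by (metis surjD)
      have "?ap (real_min_poly z) x \<bullet> (P *v w) = 0"
        using factor by blast
      thus "x \<bullet> (P *v y) = 0"
        unfolding skew_form_poly_apply[OF skew] poly_refl_real_min_poly w
        by (simp add: poly_apply_smult matrix_vector_mult_scaleR split: if_splits)
    qed
  qed simp
  hence "P *v y = 0" for y using inner_eq_zero_iff by blast
  thus ?thesis by (simp add: matrix_eq)
qed

lemma lyapunov_op_bij: "hurwitz_mat A \<Longrightarrow> bij (lyapunov_op A)"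
  using lyapunov_op_kernel_trivial linear_injective_0[OF linear_lyapunov_op]
    linear_injective_imp_surjective[OF linear_lyapunov_op] by (metis bijI)

lemma lyapunov_solution_exists:
  assumes A: "hurwitz_mat A" and W: "transpose W = W"
  shows "\<exists>P. transpose P = P \<and> lyapunov_op A P = W"
proof -
  obtain P where P: "lyapunov_op A P = W"
    using lyapunov_op_bij[OF A] by (metis bij_pointE)
  hence "lyapunov_op A (transpose P) = lyapunov_op A P"
    using W by (simp flip: transpose_lyapunov_op)
  hence "transpose P = P"
    using lyapunov_op_bij[OF A] by (metis bij_betw_def injD)
  thus ?thesis using P by blast
qed

lemma form_orthogonal_decomposition:
  fixes P :: "real^'r^'r"
  assumes N: "subspace N" and pos: "\<And>x. x \<in> N \<Longrightarrow> x \<noteq> 0 \<Longrightarrow> x \<bullet> (P *v x) > 0"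
  shows "\<exists>n\<in>N. \<exists>y. v = n + y \<and> (\<forall>m\<in>N. m \<bullet> (P *v y) = 0)"
proof -
  define K where "K = (\<lambda>m. transpose P *v m) ` N"
  define M where "M = {y. \<forall>m\<in>N. m \<bullet> (P *v y) = 0}"
  have K: "subspace K" "dim K \<le> dim N"
    using N by (simp_all add: K_def linear_subspace_image dim_image_le)
  have "orthogonal (transpose P *v m) y \<longleftrightarrow> m \<bullet> (P *v y) = 0" for m y
    unfolding orthogonal_def by (metis inner_commute inner_transpose_mult)
  hence M: "M = {y \<in> UNIV. \<forall>x\<in>K. orthogonal x y}"
    by (simp add: M_def K_def)
  have "subspace M"
    unfolding M by (auto simp: subspace_def orthogonal_clauses)
  have "dim M + dim K = DIM(real^'r)"
    unfolding M using dim_subspace_orthogonal_to_vectors[OF K(1) subspace_UNIV] by simp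
  moreover have "N \<inter> M \<subseteq> {0}" using pos by (force simp: M_def)
  hence "dim (N \<inter> M) = 0" by simp
  ultimately have "dim {n + y |n y. n \<in> N \<and> y \<in> M} \<ge> dim (UNIV :: (real^'r) set)"
    unfolding dim_UNIV using dim_sums_Int[OF N \<open>subspace M\<close>] K(2) by linarith
  hence "{n + y |n y. n \<in> N \<and> y \<in> M} = UNIV"
    by (intro subspace_dim_equal subspace_sums N \<open>subspace M\<close> subspace_UNIV subset_UNIV)
  thus ?thesis unfolding M_def by blast
qed

lemma quotient_preimage_exists:
  fixes A P :: "real^'r^'r"
  assumes N: "subspace N" and inv: "\<And>x. x \<in> N \<Longrightarrow> A *v x \<in> N"
    and pos: "\<And>x. x \<in> N \<Longrightarrow> x \<noteq> 0 \<Longrightarrow> x \<bullet> (P *v x) > 0" and \<kappa>: "\<kappa> > 0"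
    and y: "A *v (A *v y) - (2 * \<mu>) *\<^sub>R (A *v y) + \<kappa> *\<^sub>R y \<in> N" "\<And>m. m \<in> N \<Longrightarrow> m \<bullet> (P *v y) = 0"
  shows "\<exists>y' n n'. n \<in> N \<and> n' \<in> N \<and> A *v y' = y + n' \<and> A *v y = (2 * \<mu>) *\<^sub>R y - \<kappa> *\<^sub>R y' + n
    \<and> (\<forall>m\<in>N. m \<bullet> (P *v y') = 0)"
proof -
  obtain n w where n: "n \<in> N" and Ay: "A *v y = n + w" and w: "\<And>m. m \<in> N \<Longrightarrow> m \<bullet> (P *v w) = 0"
    using form_orthogonal_decomposition[OF N pos] by metis
  define y' where "y' = (1 / \<kappa>) *\<^sub>R ((2 * \<mu>) *\<^sub>R y - w)"
  define n' where "n' = (1 / \<kappa>) *\<^sub>R (A *v n - (A *v (A *v y) - (2 * \<mu>) *\<^sub>R (A *v y) + \<kappa> *\<^sub>R y))"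
  have "n' \<in> N"
    unfolding n'_def using N inv[OF n] y(1) by (intro subspace_scale subspace_diff)
  moreover have "A *v y' = y + n'"
  proof -
    have "A *v w = A *v (A *v y) - A *v n" by (simp add: Ay matrix_vector_right_distrib)
    hence "\<kappa> *\<^sub>R (A *v y') = \<kappa> *\<^sub>R (y + n')"
      using \<kappa> by (simp add: y'_def n'_def matrix_vector_mult_scaleR matrix_vector_mult_diff_distrib
          algebra_simps)
    thus ?thesis using \<kappa> by simp
  qed
  moreover have "A *v y = (2 * \<mu>) *\<^sub>R y - \<kappa> *\<^sub>R y' + n"
    using \<kappa> by (simp add: Ay y'_def)
  moreover have "m \<bullet> (P *v y') = 0" if "m \<in> N" for m
    using y(2)[OF that] w[OF that]
    by (simp add: y'_def matrix_vector_mult_scaleR matrix_vector_mult_diff_distrib inner_diff_right)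
  ultimately show ?thesis using n by blast
qed

text \<open>On the quotient by \<open>N\<close>, \<open>y\<close> is the image under \<open>A\<close> of some \<open>y'\<close>. Dissipation along \<open>y'\<close> makes \<open>y'\<^sup>T P y\<close>
  negative, and then dissipation along \<open>y\<close> makes \<open>2 \<mu> y\<^sup>T P y\<close> negative.\<close>

lemma form_pos_extend_orthogonal:
  fixes A P :: "real^'r^'r"
  assumes P: "transpose P = P" and N: "subspace N" and inv: "\<And>x. x \<in> N \<Longrightarrow> A *v x \<in> N"
    and pos: "\<And>x. x \<in> N \<Longrightarrow> x \<noteq> 0 \<Longrightarrow> x \<bullet> (P *v x) > 0"
    and dissip: "\<And>x. x \<noteq> 0 \<Longrightarrow> x \<bullet> (P *v (A *v x)) < 0"
    and \<mu>: "\<mu> < 0" and \<kappa>: "\<kappa> > 0" and "y \<noteq> 0"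
    and y: "A *v (A *v y) - (2 * \<mu>) *\<^sub>R (A *v y) + \<kappa> *\<^sub>R y \<in> N" "\<And>m. m \<in> N \<Longrightarrow> m \<bullet> (P *v y) = 0"
  shows "y \<bullet> (P *v y) > 0"
proof -
  have sym: "u \<bullet> (P *v v) = v \<bullet> (P *v u)" for u v
    by (metis P inner_commute inner_mult_sym)
  obtain y' n n' where n: "n \<in> N" and n': "n' \<in> N" and Ay': "A *v y' = y + n'"
    and Ay: "A *v y = (2 * \<mu>) *\<^sub>R y - \<kappa> *\<^sub>R y' + n" and y': "\<forall>m\<in>N. m \<bullet> (P *v y') = 0"
    using quotient_preimage_exists[OF N inv pos \<kappa> y] by blast
  have "y' \<noteq> 0"
  proof
    assume "y' = 0"
    hence "y = - n'" using Ay' by (simp add: eq_neg_iff_add_eq_0)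
    hence "y \<in> N" using n' N by (simp add: subspace_neg)
    thus False using pos[of y] y(2) \<open>y \<noteq> 0\<close> by simp
  qed
  hence "y' \<bullet> (P *v y) < 0"
    using dissip[of y'] y' n'
    by (simp add: Ay' matrix_vector_right_distrib inner_add_right sym[of y' n'])
  moreover have "2 * \<mu> * (y \<bullet> (P *v y)) - \<kappa> * (y' \<bullet> (P *v y)) < 0"
    using dissip[OF \<open>y \<noteq> 0\<close>] y(2)[OF n]
    by (simp add: Ay matrix_vector_right_distrib matrix_vector_mult_diff_distrib
        matrix_vector_mult_scaleR inner_add_right inner_diff_right sym[of y n] sym[of y y'])
  ultimately have "\<mu> * (y \<bullet> (P *v y)) < 0"
    using mult_pos_neg[OF \<kappa>] by fastforce
  thus ?thesis using \<mu> by (simp add: mult_less_0_iff)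
qed

lemma form_pos_extend:
  fixes A P :: "real^'r^'r"
  assumes P: "transpose P = P" and N: "subspace N" and inv: "\<And>x. x \<in> N \<Longrightarrow> A *v x \<in> N"
    and pos: "\<And>x. x \<in> N \<Longrightarrow> x \<noteq> 0 \<Longrightarrow> x \<bullet> (P *v x) > 0"
    and dissip: "\<And>x. x \<noteq> 0 \<Longrightarrow> x \<bullet> (P *v (A *v x)) < 0"
    and \<mu>: "\<mu> < 0" and \<kappa>: "\<kappa> > 0"
    and x: "x \<noteq> 0" "A *v (A *v x) - (2 * \<mu>) *\<^sub>R (A *v x) + \<kappa> *\<^sub>R x \<in> N"
  shows "x \<bullet> (P *v x) > 0"
proof -
  obtain n y where n: "n \<in> N" and x_eq: "x = n + y" and y: "\<And>m. m \<in> N \<Longrightarrow> m \<bullet> (P *v y) = 0"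
    using form_orthogonal_decomposition[OF N pos] by metis
  have "y \<bullet> (P *v n) = 0"
    using y[OF n] P by (metis inner_commute inner_mult_sym)
  hence split: "x \<bullet> (P *v x) = n \<bullet> (P *v n) + y \<bullet> (P *v y)"
    using y[OF n] by (simp add: x_eq matrix_vector_right_distrib inner_add_left inner_add_right)
  have y_pos: "y \<bullet> (P *v y) > 0" if "y \<noteq> 0"
  proof (rule form_pos_extend_orthogonal[OF P N inv pos dissip \<mu> \<kappa> that _ y])
    have "A *v (A *v n) - (2 * \<mu>) *\<^sub>R (A *v n) + \<kappa> *\<^sub>R n \<in> N"
      using N n inv by (intro subspace_add subspace_diff subspace_scale) auto
    hence "(A *v (A *v x) - (2 * \<mu>) *\<^sub>R (A *v x) + \<kappa> *\<^sub>R x)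
        - (A *v (A *v n) - (2 * \<mu>) *\<^sub>R (A *v n) + \<kappa> *\<^sub>R n) \<in> N"
      using N x(2) by (intro subspace_diff)
    thus "A *v (A *v y) - (2 * \<mu>) *\<^sub>R (A *v y) + \<kappa> *\<^sub>R y \<in> N"
      by (simp add: x_eq matrix_vector_right_distrib algebra_simps)
  qed
  show ?thesis
  proof (cases "n = 0")
    case True
    thus ?thesis using y_pos x(1) by (simp add: split x_eq)
  next
    case False
    thus ?thesis using y_pos pos[OF n] by (cases "y = 0") (simp_all add: split)
  qed
qed

lemma lyapunov_form_neg_imp_pos:
  fixes A P :: "real^'r^'r"
  assumes A: "hurwitz_mat A" and P: "transpose P = P"
    and dissip: "\<And>x. x \<noteq> 0 \<Longrightarrow> x \<bullet> (P *v (A *v x)) < 0" and "x \<noteq> 0"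
  shows "x \<bullet> (P *v x) > 0"
proof -
  have "x \<noteq> 0 \<longrightarrow> x \<bullet> (P *v x) > 0"
    using A
  proof (induction x rule: hurwitz_mat_vector_induct)
    case (factor z N x)
    let ?qx = "poly_apply (real_min_poly z) ((*v) A) x"
    have "A *v (A *v x) - (2 * Re z) *\<^sub>R (A *v x) + ((Re z)\<^sup>2 + (Im z)\<^sup>2) *\<^sub>R x \<in> N"
    proof (cases "Im z = 0")
      case True
      have "A *v ?qx - Re z *\<^sub>R ?qx \<in> N"
        using factor.hyps by (intro subspace_diff subspace_scale) auto
      moreover have "A *v ?qx - Re z *\<^sub>R ?qx
          = A *v (A *v x) - (2 * Re z) *\<^sub>R (A *v x) + ((Re z)\<^sup>2 + (Im z)\<^sup>2) *\<^sub>R x"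
        using True
        by (simp add: poly_apply_real_min_poly matrix_vector_mult_diff_distrib
            matrix_vector_mult_scaleR vec_eq_iff power2_eq_square algebra_simps)
      ultimately show ?thesis by simp
    next
      case False
      thus ?thesis using factor.hyps by (simp add: poly_apply_real_min_poly)
    qed
    moreover have "(Re z)\<^sup>2 + (Im z)\<^sup>2 > 0"
      using factor.hyps(1) by (simp add: sum_power2_gt_zero_iff)
    ultimately show ?case
      using form_pos_extend[OF P factor.hyps(2,3) _ dissip factor.hyps(1)] factor.IH by blast
  qed simp
  thus ?thesis using \<open>x \<noteq> 0\<close> by blast
qed

lemma lyapunov_op_neg_imp_form_neg:
  fixes A W :: "real^'r^'r"
  assumes "transpose P = P" "lyapunov_op A P = - W" "pos_def W" "x \<noteq> 0"
  shows "x \<bullet> (P *v (A *v x)) < 0"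
proof -
  have "2 * (x \<bullet> (P *v (A *v x))) = - (x \<bullet> (W *v x))"
    using lyapunov_op_form_diag[OF assms(1), of x A] by (simp add: assms(2) uminus_matrix_vector_mult)
  moreover have "x \<bullet> (W *v x) > 0" using assms(3,4) by (simp add: pos_def_def)
  ultimately show ?thesis by linarith
qed

lemma lyapunov_pos_def_solution:
  fixes A W :: "real^'r^'r"
  assumes A: "hurwitz_mat A" and W: "pos_def W"
  shows "\<exists>P. pos_def P \<and> lyapunov_op A P = - W"
proof -
  have "transpose (- W) = - W"
    using W by (simp add: pos_def_def transpose_def vec_eq_iff)
  then obtain P where P: "transpose P = P" "lyapunov_op A P = - W"
    using lyapunov_solution_exists[OF A] by blast
  have "x \<bullet> (P *v (A *v x)) < 0" if "x \<noteq> 0" for x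
    using P W that by (rule lyapunov_op_neg_imp_form_neg)
  hence "pos_def P"
    using lyapunov_form_neg_imp_pos[OF A P(1)] P(1) by (simp add: pos_def_def)
  thus ?thesis using P(2) by blast
qed

section \<open>Characteristic polynomials and resolvents\<close>

lemma coeff_mult_degree_le:
  fixes p q :: "'a::comm_semiring_0 poly"
  assumes "degree p \<le> m" "degree q \<le> n"
  shows "coeff (p * q) (m + n) = coeff p m * coeff q n"
proof -
  have "coeff p i * coeff q (m + n - i) = 0" if "i \<le> m + n" "i \<noteq> m" for i
    using that assms by (cases "i < m") (auto simp: coeff_eq_0)
  hence "(\<Sum>i\<le>m+n. coeff p i * coeff q (m + n - i)) = (\<Sum>i\<in>{m}. coeff p i * coeff q (m + n - i))"
    by (intro sum.mono_neutral_right) auto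
  thus ?thesis by (simp add: coeff_mult)
qed

lemma
  fixes f :: "'i \<Rightarrow> 'a::comm_semiring_1 poly"
  assumes "finite S" "\<And>i. i \<in> S \<Longrightarrow> degree (f i) \<le> d i"
  shows degree_prod_le: "degree (prod f S) \<le> sum d S"
    and coeff_prod_top: "coeff (prod f S) (sum d S) = (\<Prod>i\<in>S. coeff (f i) (d i))"
proof -
  have "degree (prod f S) \<le> sum d S \<and> coeff (prod f S) (sum d S) = (\<Prod>i\<in>S. coeff (f i) (d i))"
    using assms
  proof (induction S rule: finite_induct)
    case (insert i S)
    hence "degree (f i * prod f S) \<le> d i + sum d S"
      by (intro order.trans[OF degree_mult_le] add_mono) auto
    thus ?case using insert by (simp add: coeff_mult_degree_le)
  qed simp
  thus "degree (prod f S) \<le> sum d S" "coeff (prod f S) (sum d S) = (\<Prod>i\<in>S. coeff (f i) (d i))"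
    by auto
qed

lemma
  fixes M :: "'a::comm_ring_1 poly^'n^'n"
  assumes "\<And>i j. degree (M $ i $ j) \<le> d j"
  shows degree_det_le: "degree (det M) \<le> (\<Sum>j\<in>UNIV. d j)"
    and coeff_det_top: "coeff (det M) (\<Sum>j\<in>UNIV. d j) = det (\<chi> i j. coeff (M $ i $ j) (d j))"
proof -
  have smult: "of_int k * q = smult (of_int k) q" for k and q :: "'a poly"
    by (simp add: of_int_poly)
  have sum_d: "(\<Sum>i\<in>UNIV. d (\<pi> i)) = (\<Sum>j\<in>UNIV. d j)" if "\<pi> permutes UNIV" for \<pi>
    using sum.permute[OF that, of d] by (simp add: comp_def)
  show "degree (det M) \<le> (\<Sum>j\<in>UNIV. d j)"
    unfolding det_def smult
  proof (rule degree_sum_le)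
    fix \<pi> :: "'n \<Rightarrow> 'n" assume "\<pi> \<in> {\<pi>. \<pi> permutes UNIV}"
    thus "degree (smult (of_int (sign \<pi>)) (\<Prod>i\<in>UNIV. M $ i $ \<pi> i)) \<le> (\<Sum>j\<in>UNIV. d j)"
      using degree_prod_le[of UNIV "\<lambda>i. M $ i $ \<pi> i" "\<lambda>i. d (\<pi> i)"] assms
      by (simp add: sum_d order.trans[OF degree_smult_le])
  qed simp
  have "coeff (\<Prod>i\<in>UNIV. M $ i $ \<pi> i) (\<Sum>j\<in>UNIV. d j) = (\<Prod>i\<in>UNIV. coeff (M $ i $ \<pi> i) (d (\<pi> i)))"
    if "\<pi> permutes UNIV" for \<pi>
    using coeff_prod_top[of UNIV "\<lambda>i. M $ i $ \<pi> i" "\<lambda>i. d (\<pi> i)"] assms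
    by (simp add: sum_d[OF that])
  thus "coeff (det M) (\<Sum>j\<in>UNIV. d j) = det (\<chi> i j. coeff (M $ i $ j) (d j))"
    unfolding det_def smult by (simp add: coeff_sum)
qed

lemma poly_det: "poly (det M) s = det (\<chi> i j. poly (M $ i $ j) s)"
  by (simp add: det_def poly_sum poly_prod)

lemma cpoly_det: "cpoly (det M) z = det (\<chi> i j. cpoly (M $ i $ j) z)"
proof -
  have one: "cpoly 1 z = 1" by (simp add: one_pCons)
  have of_int: "cpoly (of_int k) z = of_int k" for k by (simp add: of_int_poly)
  have sum: "cpoly (sum p S) z = (\<Sum>i\<in>S. cpoly (p i) z)" for p and S :: "('a \<Rightarrow> 'a) set"
    by (induction S rule: infinite_finite_induct) simp_all
  have prod: "cpoly (prod p S) z = (\<Prod>i\<in>S. cpoly (p i) z)" for p and S :: "'a set"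
    by (induction S rule: infinite_finite_induct) (simp_all add: one)
  show ?thesis by (simp add: det_def sum prod of_int)
qed

definition char_matrix :: "real^'r^'r \<Rightarrow> real poly^'r^'r" where
  "char_matrix A = (\<chi> i j. (if i = j then [:0, 1:] else 0) - [:A $ i $ j:])"

lemma char_poly_eq_det: "char_poly A = det (char_matrix A)"
  by (simp add: char_poly_def char_matrix_def)

lemma poly_char_matrix: "(\<chi> i j. poly (char_matrix A $ i $ j) s) = s *\<^sub>R mat 1 - A"
  by (simp add: char_matrix_def vec_eq_iff mat_def)

lemma degree_char_matrix_le: "degree (char_matrix A $ i $ j) \<le> 1"
  by (auto simp: char_matrix_def intro: degree_diff_le)

lemma poly_char_poly: "poly (char_poly A) s = det (s *\<^sub>R mat 1 - A)"
  by (simp add: char_poly_eq_det poly_det poly_char_matrix)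

lemma degree_char_poly: "degree (char_poly A) = CARD('r)"
  and lead_coeff_char_poly: "lead_coeff (char_poly A) = 1"
  for A :: "real^'r^'r"
proof -
  have "(\<chi> i j. coeff (char_matrix A $ i $ j) 1) = mat 1"
    by (simp add: char_matrix_def vec_eq_iff mat_def)
  hence top: "degree (char_poly A) \<le> CARD('r)" "coeff (char_poly A) CARD('r) = 1"
    using degree_det_le[of "char_matrix A" "\<lambda>_. 1"] coeff_det_top[of "char_matrix A" "\<lambda>_. 1"]
      degree_char_matrix_le[of A]
    by (simp_all add: char_poly_eq_det)
  thus "degree (char_poly A) = CARD('r)" by (intro order.antisym le_degree) simp_all
  thus "lead_coeff (char_poly A) = 1" using top(2) by simp
qed

lemma char_poly_nonzero: "char_poly A \<noteq> 0"
  using lead_coeff_char_poly[of A] by auto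

lemma det_eq_0_iff_kernel:
  fixes M :: "'a::field^'n^'n"
  shows "det M = 0 \<longleftrightarrow> (\<exists>v. v \<noteq> 0 \<and> M *v v = 0)"
  by (metis invertible_det_nz invertible_left_inverse matrix_left_invertible_ker)

lemma hurwitz_mat_char_poly_root:
  fixes A :: "real^'r^'r"
  assumes A: "hurwitz_mat A" and z: "cpoly (char_poly A) z = 0"
  shows "Re z < 0"
proof -
  have pencil: "(\<chi> i j. cpoly (char_matrix A $ i $ j) z) = mat z - map_matrix of_real A"
    by (simp add: char_matrix_def vec_eq_iff mat_def)
  have mat_z: "mat z *v v = z *s v" for v :: "complex^'r"
    by (simp add: vec_eq_iff matrix_vector_mult_def mat_def if_distrib[of "\<lambda>c. c * _"] cong: if_cong)
  have "det (mat z - map_matrix complex_of_real A) = 0"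
    using z by (simp add: char_poly_eq_det cpoly_det pencil)
  then obtain v where "v \<noteq> 0" "(mat z - map_matrix complex_of_real A) *v v = 0"
    unfolding det_eq_0_iff_kernel by blast
  hence "v \<noteq> 0" "map_matrix complex_of_real A *v v = z *s v"
    by (simp_all add: matrix_vector_mult_diff_rdistrib mat_z)
  thus ?thesis using A unfolding hurwitz_mat_def by blast
qed

lemma hurwitz_mat_coprime_char_poly_refl:
  assumes "hurwitz_mat A"
  shows "coprime (char_poly A) (poly_refl (char_poly A))"
proof (rule real_coprime_if_no_common_root[OF char_poly_nonzero])
  fix z assume "cpoly (char_poly A) z = 0"
  hence "Re z < 0" using hurwitz_mat_char_poly_root[OF assms] by blast
  thus "cpoly (poly_refl (char_poly A)) z \<noteq> 0"
    using hurwitz_mat_char_poly_root[OF assms, of "- z"] by (auto simp: cpoly_poly_refl)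
qed

lemma hurwitz_mat_char_poly_at_0:
  assumes "hurwitz_mat A"
  shows "poly (char_poly A) 0 \<noteq> 0"
proof
  assume "poly (char_poly A) 0 = 0"
  hence "det (- A) = 0" by (simp add: poly_char_poly)
  then obtain v where "v \<noteq> 0" "A *v v = 0"
    unfolding det_eq_0_iff_kernel by (auto simp: uminus_matrix_vector_mult)
  thus False using hurwitz_mat_kernel_trivial[OF assms] by blast
qed

definition eval_vec :: "real poly^'r \<Rightarrow> real \<Rightarrow> real^'r" where
  "eval_vec U s = (\<chi> i. poly (U $ i) s)"

text \<open>By Cramer's rule, \<open>(sI - A)\<^sup>-\<^sup>1 g = eval_vec (resolvent_num A g) s / poly (char_poly A) s\<close>.\<close>

definition resolvent_num :: "real^'r^'r \<Rightarrow> real^'r \<Rightarrow> real poly^'r" where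
  "resolvent_num A g = (\<chi> k. det (\<chi> i j. if j = k then [:g $ i:] else char_matrix A $ i $ j))"

definition transfer_num :: "real^'r^'r \<Rightarrow> real^'r \<Rightarrow> real^'r \<Rightarrow> real poly" where
  "transfer_num A g m = (\<Sum>i\<in>UNIV. smult (m $ i) (resolvent_num A g $ i))"

lemma poly_sum_smult_vec: "poly (\<Sum>i\<in>UNIV. smult (m $ i) (U $ i)) s = m \<bullet> eval_vec U s"
  by (simp add: eval_vec_def poly_sum inner_vec_def)

lemma poly_transfer_num: "poly (transfer_num A g m) s = m \<bullet> eval_vec (resolvent_num A g) s"
  by (simp add: transfer_num_def poly_sum_smult_vec)

lemma infinite_nonroots:
  fixes p :: "real poly"
  assumes "p \<noteq> 0"
  shows "infinite {s. poly p s \<noteq> 0}"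
  using poly_roots_finite[OF assms] infinite_UNIV_char_0 finite_compl by (metis Collect_neg_eq)

lemma resolvent_num_eq:
  fixes A :: "real^'r^'r"
  shows "A *v eval_vec (resolvent_num A g) s
    = s *\<^sub>R eval_vec (resolvent_num A g) s - poly (char_poly A) s *\<^sub>R g"
proof -
  let ?U = "resolvent_num A g" and ?a = "char_poly A"
  have U: "eval_vec ?U s = (\<chi> k. det (\<chi> i j. if j = k then g $ i else (s *\<^sub>R mat 1 - A) $ i $ j))" for s
    unfolding eval_vec_def resolvent_num_def poly_char_matrix[symmetric]
    by (simp add: poly_det if_distrib[of "\<lambda>p. poly p s"] cong: if_cong)
  have nonroot: "A *v eval_vec ?U s = s *\<^sub>R eval_vec ?U s - poly ?a s *\<^sub>R g" if "poly ?a s \<noteq> 0" for s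
  proof -
    have "(s *\<^sub>R mat 1 - A) *v ((1 / poly ?a s) *\<^sub>R eval_vec ?U s) = g"
      using that unfolding poly_char_poly
      by (subst cramer) (simp_all add: U vec_eq_iff)
    hence g: "g = (1 / poly ?a s) *\<^sub>R (s *\<^sub>R eval_vec ?U s - A *v eval_vec ?U s)"
      by (simp add: matrix_vector_mult_scaleR matrix_vector_mult_diff_rdistrib flip: scaleR_matrix_vector_assoc)
    show ?thesis using that by (subst g) simp
  qed
  have "(\<Sum>j\<in>UNIV. smult (A $ i $ j) (?U $ j)) = [:0, 1:] * (?U $ i) - smult (g $ i) ?a" for i
  proof (rule poly_eqI_infinite[OF infinite_nonroots[OF char_poly_nonzero[of A]]])
    fix s assume "s \<in> {s. poly ?a s \<noteq> 0}"
    thus "poly (\<Sum>j\<in>UNIV. smult (A $ i $ j) (?U $ j)) s = poly ([:0, 1:] * (?U $ i) - smult (g $ i) ?a) s"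
      using nonroot[of s]
      by (simp add: poly_sum_smult_vec vec_eq_iff eval_vec_def matrix_vector_mul_component)
  qed
  hence "poly (\<Sum>j\<in>UNIV. smult (A $ i $ j) (?U $ j)) s = poly ([:0, 1:] * (?U $ i) - smult (g $ i) ?a) s" for i
    by simp
  thus ?thesis
    by (simp add: poly_sum_smult_vec vec_eq_iff eval_vec_def matrix_vector_mul_component)
qed

lemma degree_resolvent_num: "degree (resolvent_num A g $ k) < CARD('r)"
  for A :: "real^'r^'r"
proof -
  define M where "M = (\<chi> i j. if j = k then [:g $ i:] else char_matrix A $ i $ j)"
  have deg: "degree (M $ i $ j) \<le> (if j = k then 0 else 1)" for i j
    using degree_char_matrix_le[of A i j] by (simp add: M_def)
  have "degree (det M) \<le> (\<Sum>j\<in>UNIV. if j = k then 0 else 1)"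
    using deg by (rule degree_det_le)
  also have "\<dots> = card (UNIV - {k})"
    by (simp add: sum.If_cases Compl_eq_Diff_UNIV)
  also have "\<dots> < CARD('r)"
    by (intro psubset_card_mono) auto
  finally show ?thesis by (simp add: resolvent_num_def M_def)
qed

lemma degree_sum_smult_less:
  fixes U :: "real poly^'r"
  assumes "\<And>i. degree (U $ i) < n"
  shows "degree (\<Sum>i\<in>UNIV. smult (m $ i) (U $ i)) < n"
proof -
  have "degree (\<Sum>i\<in>UNIV. smult (m $ i) (U $ i)) \<le> n - 1"
  proof (rule degree_sum_le)
    show "degree (smult (m $ i) (U $ i)) \<le> n - 1" for i
      using degree_smult_le[of "m $ i" "U $ i"] assms[of i] by linarith
  qed simp
  thus ?thesis using assms[of undefined] by linarith
qed

lemma degree_transfer_num: "degree (transfer_num A g m) < CARD('r)"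
  for A :: "real^'r^'r"
  unfolding transfer_num_def by (intro degree_sum_smult_less degree_resolvent_num)

lemma transfer_num_add: "transfer_num A g (m + n) = transfer_num A g m + transfer_num A g n"
  by (simp add: transfer_num_def smult_add_left sum.distrib)

lemma transfer_num_scaleR: "transfer_num A g (c *\<^sub>R m) = smult c (transfer_num A g m)"
  by (rule poly_eqI) (simp add: transfer_num_def coeff_sum sum_distrib_left mult.assoc)

lemma transfer_num_transpose:
  "transfer_num A g (transpose A *v m) = [:0, 1:] * transfer_num A g m - smult (m \<bullet> g) (char_poly A)"
proof (rule poly_eqI_infinite[OF infinite_UNIV_char_0])
  fix s
  have "(transpose A *v m) \<bullet> eval_vec (resolvent_num A g) s = m \<bullet> (A *v eval_vec (resolvent_num A g) s)"
    by (metis inner_commute inner_transpose_mult)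
  thus "poly (transfer_num A g (transpose A *v m)) s
      = poly ([:0, 1:] * transfer_num A g m - smult (m \<bullet> g) (char_poly A)) s"
    by (simp add: poly_transfer_num resolvent_num_eq inner_diff_right mult.commute)
qed

lemma matpow_Suc: "matpow M (Suc k) = M ** matpow M k"
  by (simp add: matpow_def)

lemma controllable_transfer_num_eq_0:
  fixes A :: "real^'r^'r"
  assumes ctrb: "controllable A g" and zero: "transfer_num A g m = 0"
  shows "m = 0"
proof -
  have step: "m \<bullet> g = 0 \<and> transfer_num A g (transpose A *v m) = 0" if "transfer_num A g m = 0" for m
  proof -
    have eq: "transfer_num A g (transpose A *v m) = smult (- (m \<bullet> g)) (char_poly A)"
      using transfer_num_transpose[of A g m] that by simp
    have "coeff (transfer_num A g (transpose A *v m)) CARD('r) = 0"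
      using degree_transfer_num by (rule coeff_eq_0)
    hence "m \<bullet> g = 0"
      using lead_coeff_char_poly[of A] unfolding eq by (simp add: degree_char_poly)
    thus ?thesis using eq by simp
  qed
  have "m \<bullet> (matpow A k *v g) = 0" for k
    using zero
  proof (induction k arbitrary: m)
    case 0
    thus ?case using step by (simp add: matpow_def)
  next
    case (Suc k)
    hence "(transpose A *v m) \<bullet> (matpow A k *v g) = 0" using step by blast
    thus ?case
      unfolding matpow_Suc matrix_vector_mul_assoc[symmetric] by (metis inner_commute inner_transpose_mult)
  qed
  hence "orthogonal m x" if "x \<in> {matpow A k *v g |k. k < CARD('r)}" for x
    using that by (auto simp: orthogonal_def)
  hence "orthogonal m m"
    using ctrb orthogonal_to_span[of m "{matpow A k *v g |k. k < CARD('r)}" m]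
    by (simp add: controllable_def)
  thus ?thesis by (simp add: orthogonal_def)
qed

lemma controllable_transfer_num_surj:
  fixes A :: "real^'r^'r"
  assumes ctrb: "controllable A g" and "degree p < CARD('r)"
  shows "\<exists>m. transfer_num A g m = p"
proof -
  let ?e = "to_nat_on (UNIV :: 'r set)"
  have e: "bij_betw ?e UNIV {..<CARD('r)}"
    by (rule to_nat_on_finite) simp
  define f :: "real poly \<Rightarrow> real^'r" where "f p = (\<chi> i. coeff p (?e i))" for p
  have f_inj: "p = q" if "f p = f q" "degree p < CARD('r)" "degree q < CARD('r)" for p q
  proof (rule poly_eqI)
    fix k
    show "coeff p k = coeff q k"
    proof (cases "k < CARD('r)")
      case True
      then obtain i where "?e i = k"
        using e by (metis bij_betw_imp_surj_on imageE lessThan_iff)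
      thus ?thesis using that(1) by (auto simp: f_def vec_eq_iff)
    qed (use that in \<open>simp add: coeff_eq_0\<close>)
  qed
  have lin: "linear (\<lambda>m. f (transfer_num A g m))"
    by (intro linearI) (simp_all add: f_def vec_eq_iff transfer_num_add transfer_num_scaleR)
  have "m = 0" if "f (transfer_num A g m) = 0" for m
  proof (rule controllable_transfer_num_eq_0[OF ctrb])
    show "transfer_num A g m = 0"
      using that by (intro f_inj degree_transfer_num) (simp_all add: f_def vec_eq_iff)
  qed
  hence "inj (\<lambda>m. f (transfer_num A g m))"
    using linear_injective_0[OF lin] by blast
  hence "surj (\<lambda>m. f (transfer_num A g m))"
    using linear_injective_imp_surjective[OF lin] by simp
  then obtain m where "f p = f (transfer_num A g m)" by (rule surjE)
  hence "p = transfer_num A g m"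
    using assms(2) degree_transfer_num by (intro f_inj)
  thus ?thesis by blast
qed

section \<open>The Popov polynomial\<close>

lemma outer_mult: "outer g h *v x = (h \<bullet> x) *\<^sub>R g"
  by (simp add: outer_def vec_eq_iff matrix_vector_mult_def inner_vec_def sum_distrib_left mult_ac)

lemma det_uminus: "det (- A) = (-1) ^ CARD('n) * det A"
  for A :: "'a::comm_ring_1^'n^'n"
proof -
  have "- A = (\<chi> i. (-1) *s (A $ i))" by (simp add: vec_eq_iff)
  hence "det (- A) = (\<Prod>i\<in>(UNIV :: 'n set). -1) * det (\<chi> i. A $ i)"
    using det_rows_mul[of "\<lambda>_. -1" "\<lambda>i. A $ i"] by simp
  thus ?thesis by simp
qed

lemma det_identity_column: "det (\<chi> i j. if j = k then x $ i else mat 1 $ i $ j) = x $ k"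
  for x :: "real^'r"
  using cramer_lemma[where A = "mat 1" and x = x and k = k]
  unfolding matrix_vector_mul_lid det_I mult_1_right .

lemma det_identity_plus_outer_axis: "det (mat 1 + outer (axis k 1) w) = 1 + w $ k"
  for w :: "real^'r"
proof -
  have "transpose (mat 1 + outer (axis k 1) w) = (\<chi> i j. if j = k then (axis k 1 + w) $ i else mat 1 $ i $ j)"
    by (auto simp: vec_eq_iff transpose_def mat_def outer_def axis_def)
  hence "det (transpose (mat 1 + outer (axis k 1) w)) = (axis k 1 + w) $ k"
    by (simp only: det_identity_column)
  thus ?thesis by simp
qed

text \<open>Conjugation by the identity with column \<open>k\<close> replaced by \<open>u\<close> turns \<open>u\<close> into the \<open>k\<close>-th unit vector.\<close>

lemma det_identity_plus_outer: "det (mat 1 + outer u v) = 1 + v \<bullet> u"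
  for u v :: "real^'r"
proof (cases "u = 0")
  case True
  hence "outer u v = 0" by (simp add: outer_def vec_eq_iff)
  thus ?thesis using True by simp
next
  case False
  then obtain k where k: "u $ k \<noteq> 0" by (auto simp: vec_eq_iff)
  define T :: "real^'r^'r" where "T = (\<chi> i j. if j = k then u $ i else mat 1 $ i $ j)"
  define w where "w = transpose T *v v"
  have T_k: "T *v axis k 1 = u"
    unfolding matrix_vector_mult_basis by (simp add: T_def column_def vec_eq_iff)
  have w_inner: "w \<bullet> x = v \<bullet> (T *v x)" for x
    unfolding w_def by (metis inner_commute inner_transpose_mult)
  have "(mat 1 + outer u v) ** T = T ** (mat 1 + outer (axis k 1) w)"
    by (simp add: matrix_eq matrix_vector_mult_add_rdistrib matrix_vector_right_distrib outer_mult
        matrix_vector_mult_scaleR T_k w_inner flip: matrix_vector_mul_assoc)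
  hence "det (mat 1 + outer u v) * det T = det T * (1 + w $ k)"
    by (metis det_mul det_identity_plus_outer_axis)
  moreover have "det T = u $ k" by (simp add: T_def det_identity_column)
  moreover have "w $ k = v \<bullet> u"
    using w_inner[of "axis k 1"] by (simp add: T_k inner_axis)
  ultimately show ?thesis using k by simp
qed

text \<open>With \<open>H(s) = h\<^sup>T (sI - A)\<^sup>-\<^sup>1 g\<close> and \<open>a = char_poly A\<close>, this is \<open>2 |a|\<^sup>2 (1 + Re H)\<close> on the imaginary axis.\<close>

definition popov_poly :: "real^'r^'r \<Rightarrow> real^'r \<Rightarrow> real^'r \<Rightarrow> real poly" where
  "popov_poly A g h = smult 2 (char_poly A * poly_refl (char_poly A))
     + poly_refl (char_poly A) * transfer_num A g h + char_poly A * poly_refl (transfer_num A g h)"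

lemma poly_popov_poly:
  "poly (popov_poly A g h) s = 2 * poly (char_poly A) s * poly (char_poly A) (- s)
    + poly (char_poly A) (- s) * (h \<bullet> eval_vec (resolvent_num A g) s)
    + poly (char_poly A) s * (h \<bullet> eval_vec (resolvent_num A g) (- s))"
  by (simp add: popov_poly_def poly_pcompose poly_transfer_num)

lemma square_minus_mult_resolvent_num:
  fixes A :: "real^'r^'r"
  assumes "t\<^sup>2 = s\<^sup>2"
  shows "(s\<^sup>2 *\<^sub>R mat 1 - A ** A) *v eval_vec (resolvent_num A g) t
    = poly (char_poly A) t *\<^sub>R (t *\<^sub>R g + A *v g)"
  unfolding matrix_vector_mult_diff_rdistrib matrix_vector_mul_assoc[symmetric] resolvent_num_eq
    matrix_vector_mult_diff_distrib matrix_vector_mult_scaleR assms[symmetric]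
  by (simp add: power2_eq_square algebra_simps flip: scaleR_matrix_vector_assoc)

lemma det_square_minus:
  fixes A :: "real^'r^'r"
  shows "det (s\<^sup>2 *\<^sub>R mat 1 - A ** A) = (-1) ^ CARD('r) * (poly (char_poly A) s * poly (char_poly A) (- s))"
proof -
  have "s\<^sup>2 *\<^sub>R mat 1 - A ** A = (s *\<^sub>R mat 1 - A) ** (s *\<^sub>R mat 1 + A)"
    by (simp add: matrix_eq matrix_vector_mult_diff_rdistrib matrix_vector_mult_add_rdistrib
        matrix_vector_right_distrib matrix_vector_mult_scaleR power2_eq_square algebra_simps
        flip: scaleR_matrix_vector_assoc matrix_vector_mul_assoc)
  moreover have "s *\<^sub>R mat 1 + A = - ((- s) *\<^sub>R mat 1 - A)" by simp
  hence "det (s *\<^sub>R mat 1 + A) = (-1) ^ CARD('r) * poly (char_poly A) (- s)"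
    by (simp only: det_uminus poly_char_poly)
  ultimately show ?thesis by (simp add: det_mul poly_char_poly)
qed

lemma popov_poly_eq_char_poly:
  fixes A :: "real^'r^'r"
  assumes B: "B = A - outer g h"
  shows "popov_poly A g h = smult (2 * (-1) ^ CARD('r)) (pcompose (char_poly (A ** B)) [:0, 0, 1:])"
proof -
  let ?a = "char_poly A"
  have "?a * poly_refl ?a \<noteq> 0"
    using char_poly_nonzero[of A] pcompose_eq_0_iff[of "[:0, -1:]" ?a] by simp
  hence "infinite {s. poly (?a * poly_refl ?a) s \<noteq> 0}" by (rule infinite_nonroots)
  thus ?thesis
  proof (rule poly_eqI_infinite)
    fix s assume "s \<in> {s. poly (?a * poly_refl ?a) s \<noteq> 0}"
    hence a: "poly ?a s \<noteq> 0" "poly ?a (- s) \<noteq> 0" by (auto simp: poly_pcompose)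
    let ?U = "eval_vec (resolvent_num A g)"
    define N where "N = s\<^sup>2 *\<^sub>R mat 1 - A ** A"
    define w where "w = (1 / 2) *\<^sub>R ((1 / poly ?a s) *\<^sub>R ?U s + (1 / poly ?a (- s)) *\<^sub>R ?U (- s))"
    have "N *v w = A *v g"
      using a square_minus_mult_resolvent_num[of s s A g] square_minus_mult_resolvent_num[of "- s" s A g]
      by (simp add: N_def w_def matrix_vector_right_distrib matrix_vector_mult_scaleR flip: scaleR_add_right)
    hence "s\<^sup>2 *\<^sub>R mat 1 - A ** B = N ** (mat 1 + outer w h)"
      by (simp add: matrix_eq B N_def outer_mult matrix_vector_mult_diff_rdistrib matrix_vector_mult_add_rdistrib
          matrix_vector_right_distrib matrix_vector_mult_diff_distrib matrix_vector_mult_scaleR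
          flip: matrix_vector_mul_assoc scaleR_matrix_vector_assoc)
    hence "poly (char_poly (A ** B)) (s\<^sup>2) = det N * (1 + h \<bullet> w)"
      by (simp add: poly_char_poly det_mul det_identity_plus_outer)
    moreover have "det N = (-1) ^ CARD('r) * (poly ?a s * poly ?a (- s))"
      unfolding N_def by (rule det_square_minus)
    moreover have "poly (popov_poly A g h) s = 2 * (poly ?a s * poly ?a (- s)) * (1 + h \<bullet> w)"
      using a by (simp add: poly_popov_poly w_def inner_add_right add_divide_distrib distrib_left)
    ultimately show "poly (popov_poly A g h) s
        = poly (smult (2 * (-1) ^ CARD('r)) (pcompose (char_poly (A ** B)) [:0, 0, 1:])) s"
      by (simp add: poly_pcompose power2_eq_square)
  qed
qed

lemma char_poly_simple_zero:
  fixes M :: "real^'r^'r"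
  assumes "order 0 (char_poly M) = 1"
  shows "\<exists>p. char_poly M = pCons 0 p \<and> poly p 0 \<noteq> 0 \<and> degree p = CARD('r) - 1 \<and> lead_coeff p = 1"
proof -
  obtain p where p: "char_poly M = pCons 0 p" "poly p 0 \<noteq> 0"
    using order_decomp[OF char_poly_nonzero[of M], of 0] assms by (auto simp: poly_eq_0_iff_dvd)
  have "p \<noteq> 0" using p(2) by auto
  hence "Suc (degree p) = degree (char_poly M)" "lead_coeff p = lead_coeff (char_poly M)"
    by (simp_all add: p(1))
  hence "degree p = CARD('r) - 1" "lead_coeff p = 1"
    unfolding lead_coeff_char_poly unfolding degree_char_poly by simp_all
  thus ?thesis using p by blast
qed

lemma popov_poly_spectral_density:
  fixes A :: "real^'r^'r"
  assumes B: "B = A - outer g h"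
    and noneg: "\<And>s. s < 0 \<Longrightarrow> poly (char_poly (A ** B)) s \<noteq> 0"
    and zero1: "order 0 (char_poly (A ** B)) = 1"
  shows "\<exists>\<rho>. popov_poly A g h = poly_negsq (pCons 0 \<rho>) \<and> degree \<rho> = CARD('r) - 1 \<and> (\<forall>x\<ge>0. poly \<rho> x > 0)"
proof -
  define c :: real where "c = 2 * (-1) ^ CARD('r)"
  have "c \<noteq> 0" by (simp add: c_def)
  obtain p where p: "char_poly (A ** B) = pCons 0 p" "poly p 0 \<noteq> 0" "degree p = CARD('r) - 1" "lead_coeff p = 1"
    using char_poly_simple_zero[OF zero1] by blast
  define \<rho> where "\<rho> = smult (- c) (poly_refl p)"
  have poly_\<rho>: "poly \<rho> x = - c * poly p (- x)" for x
    by (simp add: \<rho>_def poly_pcompose)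
  have "popov_poly A g h = poly_negsq (pCons 0 \<rho>)"
    using poly_eqI_infinite[OF infinite_UNIV_char_0, of "popov_poly A g h" "poly_negsq (pCons 0 \<rho>)"]
    by (simp add: popov_poly_eq_char_poly[OF B] p(1) poly_pcompose poly_\<rho> c_def)
  moreover have "degree \<rho> = CARD('r) - 1"
    using \<open>c \<noteq> 0\<close> p(3) by (simp add: \<rho>_def)
  moreover have "poly \<rho> x > 0" if "x \<ge> 0" for x
  proof (rule poly_pos_if_no_root_ge[OF _ _ that])
    have "lead_coeff (poly_refl p) = (-1) ^ (CARD('r) - 1)"
      using p(3,4) by (subst lead_coeff_comp) simp_all
    hence "lead_coeff \<rho> = - c * (-1) ^ (CARD('r) - 1)"
      by (simp add: \<rho>_def lead_coeff_smult)
    also have "\<dots> = 2"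
      by (simp add: c_def power_eq_if[of "-1" "CARD('r)"])
    finally show "lead_coeff \<rho> > 0" by simp
    have "poly p (- x) \<noteq> 0" if "x \<ge> 0" for x
      using noneg[of "- x"] p(1,2) that by (cases "x = 0") auto
    thus "poly \<rho> x \<noteq> 0" if "x \<ge> 0" for x
      using \<open>c \<noteq> 0\<close> that by (simp add: poly_\<rho>)
  qed
  ultimately show ?thesis by blast
qed

lemma
  fixes A :: "real^'r^'r"
  shows degree_popov_poly: "degree (popov_poly A g h) = 2 * CARD('r)"
    and lead_coeff_popov_poly: "lead_coeff (popov_poly A g h) = 2 * (-1) ^ CARD('r)"
proof -
  have popov: "popov_poly A g h
      = smult (2 * (-1) ^ CARD('r)) (pcompose (char_poly (A ** (A - outer g h))) [:0, 0, 1:])"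
    by (rule popov_poly_eq_char_poly) (rule refl)
  show "degree (popov_poly A g h) = 2 * CARD('r)"
    unfolding popov by (simp add: degree_pcompose degree_char_poly)
  show "lead_coeff (popov_poly A g h) = 2 * (-1) ^ CARD('r)"
    unfolding popov lead_coeff_smult by (subst lead_coeff_comp) (simp_all add: lead_coeff_char_poly)
qed

lemma popov_poly_at_0:
  assumes B: "B = A - outer g h" and "poly (popov_poly A g h) 0 = 0" "poly (char_poly A) 0 \<noteq> 0"
  shows "B *v eval_vec (resolvent_num A g) 0 = 0"
proof -
  have "2 * poly (char_poly A) 0 * (poly (char_poly A) 0 + h \<bullet> eval_vec (resolvent_num A g) 0) = 0"
    using assms(2) by (simp add: poly_popov_poly algebra_simps)
  hence "h \<bullet> eval_vec (resolvent_num A g) 0 = - poly (char_poly A) 0"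
    using assms(3) by simp
  thus ?thesis
    by (simp add: B matrix_vector_mult_diff_rdistrib outer_mult resolvent_num_eq)
qed

definition output_spectrum :: "real^'r^'r \<Rightarrow> real^'r \<Rightarrow> real^'r^'r \<Rightarrow> real poly" where
  "output_spectrum A g B = (\<Sum>j\<in>UNIV. transfer_num A g (B $ j) * poly_refl (transfer_num A g (B $ j)))"

lemma poly_output_spectrum:
  "poly (output_spectrum A g B) s
    = (B *v eval_vec (resolvent_num A g) s) \<bullet> (B *v eval_vec (resolvent_num A g) (- s))"
  by (simp add: output_spectrum_def poly_sum poly_pcompose poly_transfer_num inner_vec_def
      matrix_vector_mul_component)

lemma degree_output_spectrum: "degree (output_spectrum A g B) < 2 * CARD('r)"
  for A :: "real^'r^'r"
proof -
  have "degree (transfer_num A g (B $ j)) \<le> CARD('r) - 1" for j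
    using degree_transfer_num[of A g "B $ j"] by linarith
  hence "degree (output_spectrum A g B) \<le> 2 * (CARD('r) - 1)"
    unfolding output_spectrum_def by (intro degree_sum_mult_poly_refl_le) simp_all
  also have "\<dots> < 2 * CARD('r)" by simp
  finally show ?thesis .
qed

lemma output_spectrum_eq_negsq:
  fixes A :: "real^'r^'r"
  assumes "B *v eval_vec (resolvent_num A g) 0 = 0"
  shows "\<exists>\<tau>. output_spectrum A g B = poly_negsq (pCons 0 \<tau>) \<and> degree \<tau> \<le> CARD('r) - 1"
proof -
  have zero: "poly (transfer_num A g (B $ j)) 0 = 0" for j
    using assms by (simp add: poly_transfer_num flip: matrix_vector_mul_component)
  have "\<exists>T. transfer_num A g (B $ j) = pCons 0 T" for j
    using zero[of j] by (cases "transfer_num A g (B $ j)") auto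
  then obtain T where T: "\<And>j. transfer_num A g (B $ j) = pCons 0 (T j)" by metis
  define S where "S = (\<Sum>j\<in>UNIV. T j * poly_refl (T j))"
  have "poly_refl (poly_refl p) = p" for p :: "real poly"
    by (simp add: pcompose_assoc[symmetric] pcompose_pCons)
  hence "poly_refl S = S" by (simp add: S_def pcompose_sum pcompose_mult mult.commute)
  then obtain \<tau> where \<tau>: "S = poly_negsq \<tau>" using even_poly_is_negsq by blast
  have "degree (T j) \<le> CARD('r) - 1" for j
    using degree_transfer_num[of A g "B $ j"] by (simp add: T degree_pCons_eq_if split: if_splits)
  hence "degree S \<le> 2 * (CARD('r) - 1)"
    unfolding S_def by (intro degree_sum_mult_poly_refl_le) auto
  hence "degree \<tau> \<le> CARD('r) - 1" by (simp add: \<tau> degree_pcompose)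
  moreover have "output_spectrum A g B = [:0, 0, -1:] * S"
    by (simp add: output_spectrum_def T S_def pcompose_pCons sum_distrib_left sum_negf)
  hence "output_spectrum A g B = poly_negsq (pCons 0 \<tau>)"
    by (simp add: \<tau> pcompose_pCons)
  ultimately show ?thesis by blast
qed

lemma spectral_factor_popov_poly:
  fixes A :: "real^'r^'r"
  assumes A: "hurwitz_mat A" and B: "B = A - outer g h"
    and noneg: "\<And>s. s < 0 \<Longrightarrow> poly (char_poly (A ** B)) s \<noteq> 0"
    and zero1: "order 0 (char_poly (A ** B)) = 1"
  shows "\<exists>\<epsilon>>0. \<exists>d. d * poly_refl d = popov_poly A g h - smult \<epsilon> (output_spectrum A g B)
    \<and> lead_coeff d > 0 \<and> poly d 0 = 0"
proof -
  obtain \<rho> where \<rho>: "popov_poly A g h = poly_negsq (pCons 0 \<rho>)" "degree \<rho> = CARD('r) - 1"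
      "\<And>x. x \<ge> 0 \<Longrightarrow> poly \<rho> x > 0"
    using popov_poly_spectral_density[OF B noneg zero1] by blast
  have "poly (popov_poly A g h) 0 = 0" by (simp add: \<rho>(1) poly_pcompose)
  then obtain \<tau> where \<tau>: "output_spectrum A g B = poly_negsq (pCons 0 \<tau>)" "degree \<tau> \<le> degree \<rho>"
    using output_spectrum_eq_negsq[OF popov_poly_at_0[OF B]] hurwitz_mat_char_poly_at_0[OF A]
    unfolding \<rho>(2) by blast
  obtain \<epsilon> where \<epsilon>: "\<epsilon> > 0" "\<And>x. x \<ge> 0 \<Longrightarrow> poly (\<rho> - smult \<epsilon> \<tau>) x > 0"
    using poly_perturb_pos[OF \<rho>(3) \<tau>(2)] by blast
  obtain e where e: "e * poly_refl e = poly_negsq (\<rho> - smult \<epsilon> \<tau>)" "lead_coeff e > 0"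
    using spectral_factor[OF \<epsilon>(2)] by blast
  have "pCons 0 e * poly_refl (pCons 0 e) = [:0, 0, -1:] * (e * poly_refl e)"
    by (simp add: pcompose_pCons)
  also have "\<dots> = popov_poly A g h - smult \<epsilon> (output_spectrum A g B)"
    unfolding e \<rho>(1) \<tau>(1) by (simp add: pcompose_pCons pcompose_diff pcompose_smult)
  finally show ?thesis
    using \<epsilon>(1) e(2) by (intro exI[of _ \<epsilon>] exI[of _ "pCons 0 e"] conjI) auto
qed

lemma degree_spectral_factor_diff_char_poly:
  fixes A :: "real^'r^'r"
  assumes d: "d * poly_refl d = popov_poly A g h - smult \<epsilon> (output_spectrum A g B)" "lead_coeff d > 0"
  shows "degree (d - smult (sqrt 2) (char_poly A)) < CARD('r)"
proof -
  have deg_less: "degree (- smult \<epsilon> (output_spectrum A g B)) < degree (popov_poly A g h)"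
    using degree_output_spectrum[of A g B] by (simp add: degree_popov_poly)
  have d_sum: "d * poly_refl d = - smult \<epsilon> (output_spectrum A g B) + popov_poly A g h"
    by (simp add: d(1))
  have "degree (d * poly_refl d) = 2 * CARD('r)"
    unfolding d_sum degree_add_eq_right[OF deg_less] by (rule degree_popov_poly)
  hence deg: "degree d = CARD('r)" unfolding degree_mult_poly_refl by simp
  have "lead_coeff (d * poly_refl d) = 2 * (-1) ^ CARD('r)"
    unfolding d_sum lead_coeff_add_le[OF deg_less] by (rule lead_coeff_popov_poly)
  hence "(lead_coeff d)\<^sup>2 = 2"
    unfolding lead_coeff_mult_poly_refl unfolding deg by simp
  hence lead: "lead_coeff d = sqrt 2"
    using d(2) by (intro real_sqrt_unique[symmetric]) auto
  have "coeff (d - smult (sqrt 2) (char_poly A)) k = 0" if "k \<ge> CARD('r)" for k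
    using that lead deg lead_coeff_char_poly[of A] degree_char_poly[of A]
    by (cases "k = CARD('r)") (auto simp: coeff_eq_0)
  thus ?thesis by (intro degree_lessI) auto
qed

lemma spectral_vector_exists:
  fixes A :: "real^'r^'r" and g :: "real^'r"
  assumes A: "hurwitz_mat A" and ctrb: "controllable A g" and B: "B = A - outer g h"
    and noneg: "\<And>s. s < 0 \<Longrightarrow> poly (char_poly (A ** B)) s \<noteq> 0"
    and zero1: "order 0 (char_poly (A ** B)) = 1"
  defines "a \<equiv> poly (char_poly A)" and "U \<equiv> eval_vec (resolvent_num A g)"
  shows "\<exists>\<epsilon>>0. \<exists>q. sqrt 2 * a 0 + q \<bullet> U 0 = 0 \<and>
    (\<forall>s. (sqrt 2 * a s + q \<bullet> U s) * (sqrt 2 * a (- s) + q \<bullet> U (- s))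
      = poly (popov_poly A g h) s - \<epsilon> * ((B *v U s) \<bullet> (B *v U (- s))))"
proof -
  obtain \<epsilon> d where \<epsilon>: "\<epsilon> > 0"
    and d: "d * poly_refl d = popov_poly A g h - smult \<epsilon> (output_spectrum A g B)"
      "lead_coeff d > 0" "poly d 0 = 0"
    using spectral_factor_popov_poly[OF A B noneg zero1] by blast
  obtain q where "transfer_num A g q = d - smult (sqrt 2) (char_poly A)"
    using controllable_transfer_num_surj[OF ctrb degree_spectral_factor_diff_char_poly[OF d(1,2)]] by blast
  hence d_eq: "poly d s = sqrt 2 * a s + q \<bullet> U s" for s
    unfolding U_def poly_transfer_num[symmetric] by (simp add: a_def)
  have "poly d s * poly d (- s) = poly (popov_poly A g h) s - \<epsilon> * ((B *v U s) \<bullet> (B *v U (- s)))" for s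
    using arg_cong[OF d(1), of "\<lambda>p. poly p s"] by (simp add: poly_pcompose poly_output_spectrum U_def)
  thus ?thesis using \<epsilon> d(3) unfolding d_eq by blast
qed

section \<open>A common Lyapunov matrix\<close>

definition dissipative :: "real^'r^'r \<Rightarrow> real^'r^'r \<Rightarrow> bool" where
  "dissipative P M \<longleftrightarrow> (\<forall>w. M *v w \<noteq> 0 \<longrightarrow> w \<bullet> (P *v (M *v w)) < 0)"

lemma lyapunov_op_resolvent:
  fixes A P :: "real^'r^'r" and g :: "real^'r"
  assumes P: "transpose P = P"
  defines "a \<equiv> poly (char_poly A)" and "U \<equiv> eval_vec (resolvent_num A g)"
  shows "U (- s) \<bullet> (lyapunov_op A P *v U s) = - (a (- s) * ((P *v g) \<bullet> U s) + a s * ((P *v g) \<bullet> U (- s)))"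
proof -
  have sym: "u \<bullet> (P *v v) = (P *v u) \<bullet> v" for u v by (simp add: inner_mult_sym[OF P])
  have "(P *v U (- s)) \<bullet> g = (P *v g) \<bullet> U (- s)" by (metis sym inner_commute)
  moreover have "g \<bullet> (P *v U s) = (P *v g) \<bullet> U s" by (rule sym)
  moreover have "U (- s) \<bullet> (P *v U s) = (P *v U (- s)) \<bullet> U s" by (rule sym)
  ultimately show ?thesis
    by (simp add: lyapunov_op_form U_def a_def resolvent_num_eq matrix_vector_mult_diff_distrib
        matrix_vector_mult_uminus matrix_vector_mult_scaleR inner_diff_left inner_diff_right sym)
qed

text \<open>The factorization makes \<open>a(-s) f\<^sup>T U(s) + a(s) f\<^sup>T U(-s)\<close> vanish for the defect \<open>f = P g - h + \<surd>2 q\<close>;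
  as \<open>a\<close> is coprime to its reflection, it divides \<open>f\<^sup>T U\<close>, which has smaller degree.\<close>

lemma lyapunov_op_popov:
  fixes A P R :: "real^'r^'r" and g h q :: "real^'r"
  assumes A: "hurwitz_mat A" and ctrb: "controllable A g"
    and P: "transpose P = P" "lyapunov_op A P = - (outer q q + R)"
  defines "a \<equiv> poly (char_poly A)" and "U \<equiv> eval_vec (resolvent_num A g)"
  assumes q: "\<And>s. (sqrt 2 * a s + q \<bullet> U s) * (sqrt 2 * a (- s) + q \<bullet> U (- s))
      = poly (popov_poly A g h) s - U (- s) \<bullet> (R *v U s)"
  shows "P *v g = h - sqrt 2 *\<^sub>R q"
proof -
  define f where "f = P *v g - h + sqrt 2 *\<^sub>R q"
  have "a (- s) * (f \<bullet> U s) + a s * (f \<bullet> U (- s)) = 0" for s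
  proof -
    have "a (- s) * ((P *v g) \<bullet> U s) + a s * ((P *v g) \<bullet> U (- s))
        = (q \<bullet> U s) * (q \<bullet> U (- s)) + U (- s) \<bullet> (R *v U s)"
      using lyapunov_op_resolvent[OF P(1), of A g s]
      by (simp add: P(2) uminus_matrix_vector_mult matrix_vector_mult_diff_rdistrib outer_mult inner_diff_right
          inner_commute[of _ q] a_def U_def)
    moreover have "poly (popov_poly A g h) s
        = 2 * a s * a (- s) + a (- s) * (h \<bullet> U s) + a s * (h \<bullet> U (- s))"
      by (simp add: poly_popov_poly a_def U_def)
    ultimately show ?thesis
      using q[of s] by (simp add: f_def inner_add_left inner_diff_left algebra_simps)
  qed
  hence "poly_refl (char_poly A) * transfer_num A g f + char_poly A * poly_refl (transfer_num A g f) = 0"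
    by (intro poly_eqI_infinite[OF infinite_UNIV_char_0])
      (simp add: poly_pcompose poly_transfer_num a_def U_def)
  hence "char_poly A dvd poly_refl (char_poly A) * transfer_num A g f"
    by (metis add_eq_0_iff2 dvd_minus_iff dvd_triv_left)
  hence "char_poly A dvd transfer_num A g f"
    using hurwitz_mat_coprime_char_poly_refl[OF A] by (simp add: coprime_dvd_mult_right_iff)
  hence "transfer_num A g f = 0"
    using degree_transfer_num[of A g f] dvd_imp_degree_le degree_char_poly[of A] by (metis linorder_not_le)
  hence "f = 0" by (rule controllable_transfer_num_eq_0[OF ctrb])
  thus ?thesis by (simp add: f_def algebra_simps)
qed

definition popov_weight :: "real \<Rightarrow> real^'r \<Rightarrow> real^'r^'r \<Rightarrow> real^'r^'r" where
  "popov_weight \<epsilon> q B = outer q q + \<epsilon> *\<^sub>R (transpose B ** B)"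

lemma popov_weight_form:
  "x \<bullet> (popov_weight \<epsilon> q B *v y) = (q \<bullet> x) * (q \<bullet> y) + \<epsilon> * ((B *v x) \<bullet> (B *v y))"
  by (simp add: popov_weight_def matrix_vector_mult_add_rdistrib inner_add_right outer_mult
      inner_commute inner_transpose_mult flip: scaleR_matrix_vector_assoc matrix_vector_mul_assoc)

lemma pos_def_popov_weight:
  fixes A :: "real^'r^'r"
  assumes A: "hurwitz_mat A" and B: "B = A - outer g h" and \<epsilon>: "\<epsilon> > 0"
    and q: "sqrt 2 * poly (char_poly A) 0 + q \<bullet> eval_vec (resolvent_num A g) 0 = 0"
  shows "pos_def (popov_weight \<epsilon> q B)"
proof -
  let ?a = "poly (char_poly A) 0" and ?U = "eval_vec (resolvent_num A g) 0"
  have form: "x \<bullet> (popov_weight \<epsilon> q B *v x) = (q \<bullet> x)\<^sup>2 + \<epsilon> * (norm (B *v x))\<^sup>2" for x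
    by (simp add: popov_weight_form power2_eq_square dot_square_norm flip: power2_norm_eq_inner)
  have kernel: "x = 0" if "q \<bullet> x = 0" "B *v x = 0" for x
  proof -
    have "A *v x = (h \<bullet> x) *\<^sub>R g"
      using that(2) by (simp add: B matrix_vector_mult_diff_rdistrib outer_mult)
    hence "A *v (?a *\<^sub>R x + (h \<bullet> x) *\<^sub>R ?U) = 0"
      by (simp add: matrix_vector_right_distrib matrix_vector_mult_scaleR resolvent_num_eq)
    hence x: "?a *\<^sub>R x + (h \<bullet> x) *\<^sub>R ?U = 0" by (rule hurwitz_mat_kernel_trivial[OF A])
    hence "(h \<bullet> x) * (q \<bullet> ?U) = 0"
      using that(1) by (metis inner_add_right inner_scaleR_right inner_zero_right mult_zero_right add_0)
    hence "h \<bullet> x = 0" using q hurwitz_mat_char_poly_at_0[OF A] by auto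
    thus "x = 0" using x hurwitz_mat_char_poly_at_0[OF A] by simp
  qed
  have "x \<bullet> (popov_weight \<epsilon> q B *v x) > 0" if "x \<noteq> 0" for x
  proof -
    have "q \<bullet> x \<noteq> 0 \<or> B *v x \<noteq> 0" using kernel that by blast
    thus ?thesis using \<epsilon> unfolding form by (auto intro: add_pos_nonneg add_nonneg_pos)
  qed
  moreover have "transpose (popov_weight \<epsilon> q B) = popov_weight \<epsilon> q B"
    by (simp add: popov_weight_def vec_eq_iff transpose_def outer_def matrix_matrix_mult_def mult.commute)
  ultimately show ?thesis by (simp add: pos_def_def)
qed

lemma rank_one_update_dissipative:
  assumes B: "B = A - outer g h" and P: "transpose P = P" "lyapunov_op A P = - popov_weight \<epsilon> q B"
    and Pg: "P *v g = h - sqrt 2 *\<^sub>R q" and \<epsilon>: "\<epsilon> > 0"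
  shows "dissipative P B"
  unfolding dissipative_def
proof (intro allI impI)
  fix w assume "B *v w \<noteq> 0"
  have "w \<bullet> (P *v (B *v w)) = w \<bullet> (P *v (A *v w)) - (h \<bullet> w) * (w \<bullet> (P *v g))"
    by (simp add: B matrix_vector_mult_diff_rdistrib outer_mult matrix_vector_mult_diff_distrib
        matrix_vector_mult_scaleR inner_diff_right)
  hence "2 * (w \<bullet> (P *v (B *v w))) = - (w \<bullet> (popov_weight \<epsilon> q B *v w)) - 2 * (h \<bullet> w) * (w \<bullet> (P *v g))"
    using lyapunov_op_form_diag[OF P(1), of w A] by (simp add: P(2) uminus_matrix_vector_mult)
  also have "\<dots> = - ((q \<bullet> w - sqrt 2 * (h \<bullet> w))\<^sup>2 + \<epsilon> * (norm (B *v w))\<^sup>2)"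
    by (simp add: popov_weight_form Pg inner_diff_right inner_commute[of w] power2_eq_square
        power2_norm_eq_inner[unfolded power2_eq_square] algebra_simps)
  also have "\<dots> < 0"
    using \<epsilon> \<open>B *v w \<noteq> 0\<close> by (simp only: neg_less_0_iff_less) (intro add_nonneg_pos, simp_all)
  finally show "w \<bullet> (P *v (B *v w)) < 0" by simp
qed

lemma common_lyapunov_matrix_exists:
  fixes A :: "real^'r^'r"
  assumes A: "hurwitz_mat A" and ctrb: "controllable A g" and B: "B = A - outer g h"
    and noneg: "\<And>s. s < 0 \<Longrightarrow> poly (char_poly (A ** B)) s \<noteq> 0"
    and zero1: "order 0 (char_poly (A ** B)) = 1"
  shows "\<exists>P. pos_def P \<and> dissipative P A \<and> dissipative P B"
proof -
  let ?U = "eval_vec (resolvent_num A g)" and ?a = "poly (char_poly A)"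
  obtain \<epsilon> q where \<epsilon>: "\<epsilon> > 0" and q_0: "sqrt 2 * ?a 0 + q \<bullet> ?U 0 = 0"
    and q: "\<And>s. (sqrt 2 * ?a s + q \<bullet> ?U s) * (sqrt 2 * ?a (- s) + q \<bullet> ?U (- s))
      = poly (popov_poly A g h) s - \<epsilon> * ((B *v ?U s) \<bullet> (B *v ?U (- s)))"
    using spectral_vector_exists[OF A ctrb B noneg zero1] by blast
  have W: "pos_def (popov_weight \<epsilon> q B)"
    using A B \<epsilon> q_0 by (rule pos_def_popov_weight)
  then obtain P where P: "pos_def P" "lyapunov_op A P = - popov_weight \<epsilon> q B"
    using lyapunov_pos_def_solution[OF A] by blast
  hence sym: "transpose P = P" by (simp add: pos_def_def)
  have "dissipative P A"
    unfolding dissipative_def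
    using lyapunov_op_neg_imp_form_neg[OF sym P(2) W] by (metis matrix_vector_mult_0_right)
  moreover have "P *v g = h - sqrt 2 *\<^sub>R q"
  proof (rule lyapunov_op_popov[OF A ctrb sym P(2)[unfolded popov_weight_def]])
    show "(sqrt 2 * ?a s + q \<bullet> ?U s) * (sqrt 2 * ?a (- s) + q \<bullet> ?U (- s))
        = poly (popov_poly A g h) s - ?U (- s) \<bullet> ((\<epsilon> *\<^sub>R (transpose B ** B)) *v ?U s)" for s
      by (simp add: q inner_transpose_mult inner_commute flip: scaleR_matrix_vector_assoc matrix_vector_mul_assoc)
  qed
  hence "dissipative P B"
    using B sym P(2) \<epsilon> by (intro rank_one_update_dissipative)
  ultimately show ?thesis using P(1) by blast
qed

section \<open>Reduction of descriptor systems\<close>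

lemma decseq_subspace_stationary:
  fixes D :: "nat \<Rightarrow> 'a::euclidean_space set"
  assumes sub: "\<And>k. subspace (D k)" and dec: "\<And>k. D (Suc k) \<subseteq> D k"
  shows "\<exists>k. D (Suc k) = D k"
proof (rule ccontr)
  assume "\<nexists>k. D (Suc k) = D k"
  hence drop: "dim (D (Suc k)) < dim (D k)" for k
    using subspace_dim_equal[OF sub sub dec] by (meson linorder_not_less)
  have "dim (D k) + k \<le> dim (D 0)" for k
  proof (induction k)
    case (Suc k)
    thus ?case using drop[of k] by simp
  qed simp
  from this[of "Suc (dim (D 0))"] show False by simp
qed

lemma linear_surj_on_imp_kernel_trivial:
  fixes f :: "'a::euclidean_space \<Rightarrow> 'a"
  assumes f: "linear f" and V: "subspace V" and image: "f ` V = V" and x: "x \<in> V" "f x = 0"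
  shows "x = 0"
proof -
  obtain C where C: "C \<subseteq> V" "independent C" "V \<subseteq> span C" "card C = dim V"
    using basis_exists[of V] by blast
  have fin: "finite C" using C(2) independent_imp_finite by blast
  have span: "V \<subseteq> span (f ` C)"
    using C(3) image linear_span_image[OF f, of C] by blast
  have "card (f ` C) \<le> dim V" using card_image_le[OF fin, of f] C(4) by simp
  moreover have "f ` C \<subseteq> V" using C(1) image by blast
  ultimately have indep: "independent (f ` C)"
    using card_le_dim_spanning span fin by blast
  have "dim V \<le> card (f ` C)" using span fin by (intro dim_le_card) auto
  hence "inj_on f C" using fin \<open>card (f ` C) \<le> dim V\<close> C(4) by (intro eq_card_imp_inj_on) auto
  thus ?thesis using linear_indep_image_lemma[OF f fin indep] x C(3) by blast
qed

lemma matpow_Suc_right: "matpow M (Suc k) = matpow M k ** M"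
  by (induction k) (simp_all add: matpow_def matrix_mul_assoc)

lemma mat_image_matpow_desc_index:
  "mat_image (matpow (matrix_inv A ** E) (Suc (desc_index E A)))
    = mat_image (matpow (matrix_inv A ** E) (desc_index E A))"
proof -
  let ?D = "\<lambda>k. mat_image (matpow (matrix_inv A ** E) k)"
  have "\<exists>k. ?D (Suc k) = ?D k"
  proof (rule decseq_subspace_stationary)
    show "subspace (?D k)" for k
      unfolding mat_image_def by (intro linear_subspace_image) auto
    show "?D (Suc k) \<subseteq> ?D k" for k
      unfolding mat_image_def matpow_Suc_right by (auto simp flip: matrix_vector_mul_assoc)
  qed
  thus ?thesis unfolding desc_index_def by (rule LeastI_ex)
qed

lemma map_matrix_of_real_mult:
  "map_matrix complex_of_real (M ** N) = map_matrix of_real M ** map_matrix of_real N"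
  by (simp add: vec_eq_iff matrix_matrix_mult_def)

lemma map_matrix_of_real_kernel_trivial:
  fixes M :: "real^'m^'n"
  assumes "\<And>x. M *v x = 0 \<Longrightarrow> x = 0" and ker: "map_matrix complex_of_real M *v v = 0"
  shows "v = 0"
proof -
  obtain L where "L ** M = mat 1"
    using assms(1) matrix_left_invertible_ker by blast
  hence "map_matrix complex_of_real L ** map_matrix of_real M = map_matrix of_real (mat 1)"
    by (simp flip: map_matrix_of_real_mult)
  also have "\<dots> = mat 1" by (simp add: vec_eq_iff mat_def)
  finally show ?thesis
    using ker by (metis matrix_vector_mul_assoc matrix_vector_mul_lid matrix_vector_mult_0_right)
qed

locale descriptor =
  fixes E A :: "real^'n^'n" and X Y :: "real^'r^'n" and Et :: "real^'r^'r"
  assumes inv: "invertible A" and frd: "full_rank_decomp E X Y"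
    and Et_def: "Et = transpose Y ** matrix_inv A ** X"
begin

definition state_mat :: "real^'r^'n" where
  "state_mat = matrix_inv A ** X"

lemma A_matrix_inv: "A ** matrix_inv A = mat 1" "matrix_inv A ** A = mat 1"
  using someI_ex[OF inv[unfolded invertible_def]] by (simp_all add: matrix_inv_def)

lemma A_mult_state_mat: "A ** state_mat = X"
  by (simp add: state_mat_def matrix_mul_assoc A_matrix_inv)

lemma E_mult_state_mat: "E ** state_mat = X ** Et"
  using frd by (simp add: full_rank_decomp_def state_mat_def Et_def matrix_mul_assoc)

lemma X_kernel_trivial: "X *v u = 0 \<Longrightarrow> u = 0"
  using frd full_rank_injective[of X] by (auto simp: full_rank_decomp_def dest: injD[of _ u 0])

lemma state_mat_kernel_trivial: "state_mat *v u = 0 \<Longrightarrow> u = 0"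
  by (metis A_mult_state_mat X_kernel_trivial matrix_vector_mul_assoc matrix_vector_mult_0_right)

lemma surj_transpose_Y: "surj ((*v) (transpose Y))"
  using frd by (simp add: full_rank_decomp_def rank_transpose flip: full_rank_surjective)

lemma descriptor_eq_reduced:
  assumes "E *v v = A *v x"
  shows "x = state_mat *v (transpose Y *v v)" "transpose Y *v x = Et *v (transpose Y *v v)"
proof -
  have "matrix_inv A *v (A *v x) = matrix_inv A *v (E *v v)"
    using assms by simp
  thus "x = state_mat *v (transpose Y *v v)"
    using frd by (simp add: full_rank_decomp_def state_mat_def A_matrix_inv
        matrix_vector_mul_assoc matrix_mul_assoc)
  thus "transpose Y *v x = Et *v (transpose Y *v v)"
    by (simp add: Et_def state_mat_def matrix_vector_mul_assoc matrix_mul_assoc)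
qed

lemma matpow_Suc_eq: "matpow (matrix_inv A ** E) (Suc k) = state_mat ** matpow Et k ** transpose Y"
proof (induction k)
  case 0
  show ?case using frd by (simp add: matpow_def full_rank_decomp_def state_mat_def matrix_mul_assoc)
next
  case (Suc k)
  have "matrix_inv A ** E ** state_mat = state_mat ** Et"
    unfolding matrix_mul_assoc[symmetric] E_mult_state_mat by (simp add: state_mat_def matrix_mul_assoc)
  thus ?case
    unfolding matpow_Suc[of _ "Suc k"] Suc by (simp add: matpow_Suc matrix_mul_assoc)
qed

lemma mat_image_matpow_Suc:
  "mat_image (matpow (matrix_inv A ** E) (Suc k)) = (*v) state_mat ` mat_image (matpow Et k)"
proof -
  have "mat_image (matpow (matrix_inv A ** E) (Suc k))
      = (*v) state_mat ` (*v) (matpow Et k) ` range ((*v) (transpose Y))"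
    by (simp add: mat_image_def matpow_Suc_eq image_image matrix_vector_mul_assoc matrix_mul_assoc)
  thus ?thesis by (simp add: surj_transpose_Y mat_image_def)
qed

lemma mat_image_reduced_stationary:
  assumes "desc_index E A = Suc k"
  shows "mat_image (matpow Et (Suc k)) = mat_image (matpow Et k)"
proof -
  have "inj ((*v) state_mat)"
    using state_mat_kernel_trivial by (simp add: linear_injective_0)
  moreover have "(*v) state_mat ` mat_image (matpow Et (Suc k)) = (*v) state_mat ` mat_image (matpow Et k)"
    using mat_image_matpow_desc_index[of A E] unfolding assms mat_image_matpow_Suc .
  ultimately show ?thesis by (simp add: inj_image_eq_iff)
qed

lemma index_one_kernel_trivial:
  assumes "desc_index E A = 1" "Et *v u = 0"
  shows "u = 0"
proof -
  have "surj ((*v) Et)"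
    using mat_image_reduced_stationary[of 0] assms(1) by (simp add: mat_image_def matpow_def)
  thus ?thesis
    using linear_surj_on_imp_kernel_trivial[of "(*v) Et" UNIV] assms(2) by simp
qed

lemma index_two_kernel_inter_range_trivial:
  assumes "desc_index E A = 2" "w \<in> range ((*v) Et)" "Et *v w = 0"
  shows "w = 0"
proof (rule linear_surj_on_imp_kernel_trivial[where f = "(*v) Et", OF _ _ _ assms(2,3)])
  show "linear ((*v) Et)" by simp
  show "subspace (range ((*v) Et))" by (intro linear_subspace_image) auto
  show "(*v) Et ` range ((*v) Et) = range ((*v) Et)"
    using mat_image_reduced_stationary[of 1] assms(1)
    by (simp add: mat_image_def matpow_def image_image matrix_vector_mul_assoc numeral_2_eq_2)
qed

text \<open>An eigenvalue \<open>z\<close> of \<open>Et\<close> with eigenvector \<open>v\<close> is the reciprocal of a root of \<open>det(sE - A)\<close>,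
  with kernel vector \<open>state_mat v\<close>.\<close>

lemma stable_imp_hurwitz_mat:
  assumes stable: "desc_stable E A" and ker: "\<And>u. Et *v u = 0 \<Longrightarrow> u = 0"
  shows "hurwitz_mat Et"
  unfolding hurwitz_mat_def
proof (intro allI impI)
  fix z v
  let ?c = "map_matrix complex_of_real"
  assume v: "v \<noteq> 0" "?c Et *v v = z *s v"
  have "z \<noteq> 0"
    using map_matrix_of_real_kernel_trivial[where M = Et and v = v, OF ker] v by auto
  define x where "x = ?c state_mat *v v"
  have "?c E *v x = ?c (X ** Et) *v v"
    by (simp add: x_def matrix_vector_mul_assoc flip: E_mult_state_mat map_matrix_of_real_mult)
  also have "\<dots> = z *s (?c X *v v)"
    by (simp add: map_matrix_of_real_mult v(2) vector_scalar_commute flip: matrix_vector_mul_assoc)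
  finally have Ex: "?c E *v x = z *s (?c X *v v)" .
  have Ax: "?c A *v x = ?c X *v v"
    by (simp add: x_def matrix_vector_mul_assoc A_mult_state_mat flip: map_matrix_of_real_mult)
  let ?M = "\<chi> i j. (1 / z) * complex_of_real (E $ i $ j) - complex_of_real (A $ i $ j)"
  have "?M *v x = (1 / z) *s (?c E *v x) - ?c A *v x"
    by (simp add: vec_eq_iff matrix_vector_mult_def sum_distrib_left sum_subtractf algebra_simps)
  also have "\<dots> = 0" using \<open>z \<noteq> 0\<close> by (simp add: Ex Ax)
  finally have "det ?M = 0"
    using map_matrix_of_real_kernel_trivial[where M = state_mat and v = v, OF state_mat_kernel_trivial]
      v(1) x_def
    unfolding det_eq_0_iff_kernel by blast
  hence "Re (1 / z) < 0" using stable unfolding desc_stable_def by blast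
  hence "Re z / ((Re z)\<^sup>2 + (Im z)\<^sup>2) < 0" by (simp add: Re_divide)
  moreover have "(Re z)\<^sup>2 + (Im z)\<^sup>2 \<ge> 0" by simp
  ultimately show "Re z < 0" by (simp only: divide_less_0_iff) linarith
qed

end

section \<open>Homogeneous functions and exponential decay\<close>

lemma continuous_on_matrix_vector_mult [continuous_intros]:
  "continuous_on S f \<Longrightarrow> continuous_on S (\<lambda>x. M *v f x)"
  for M :: "real^'m^'n"
  by (rule bounded_linear.continuous_on[OF matrix_vector_mul_bounded_linear])

lemma homogeneous_dominated:
  fixes f g :: "'a::euclidean_space \<Rightarrow> real"
  assumes V: "subspace V" and k: "k > 0"
    and cont: "continuous_on UNIV f" "continuous_on UNIV g"
    and hom: "\<And>c x. f (c *\<^sub>R x) = \<bar>c\<bar> ^ k * f x" "\<And>c x. g (c *\<^sub>R x) = \<bar>c\<bar> ^ k * g x"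
    and pos: "\<And>x. x \<in> V \<Longrightarrow> x \<noteq> 0 \<Longrightarrow> g x > 0"
  shows "\<exists>C>0. \<forall>x\<in>V. f x \<le> C * g x"
proof -
  let ?S = "V \<inter> sphere 0 1"
  have pos_S: "g x > 0" if "x \<in> ?S" for x
    using that by (intro pos) auto
  have "compact ?S"
    using closed_subspace[OF V] by (intro closed_Int_compact) auto
  moreover have "continuous_on ?S (\<lambda>x. f x / g x)"
    using pos_S by (intro continuous_on_divide cont[THEN continuous_on_subset]) (auto simp: less_le)
  ultimately have "bounded ((\<lambda>x. f x / g x) ` ?S)"
    by (intro compact_imp_bounded compact_continuous_image)
  then obtain C where C: "C > 0" "\<And>x. x \<in> ?S \<Longrightarrow> \<bar>f x / g x\<bar> \<le> C"
    by (auto simp: bounded_pos)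
  have "f x \<le> C * g x" if "x \<in> V" for x
  proof (cases "x = 0")
    case True
    thus ?thesis using hom(1)[of 0 0] hom(2)[of 0 0] k by (simp add: zero_power)
  next
    case False
    define u where "u = (1 / norm x) *\<^sub>R x"
    have u: "u \<in> ?S" using V that False by (simp add: u_def subspace_scale)
    have x: "x = norm x *\<^sub>R u" using False by (simp add: u_def)
    have "f u \<le> C * g u"
      using C(2)[OF u] pos_S[OF u] by (simp add: abs_le_iff field_simps)
    hence "norm x ^ k * f u \<le> C * (norm x ^ k * g u)"
      using mult_left_mono[of "f u" "C * g u" "norm x ^ k"] by (simp add: mult_ac)
    thus ?thesis
      using hom[of "norm x" u] by (simp flip: x)
  qed
  thus ?thesis using C(1) by blast
qed

lemma homogeneous_dominated_uniform:
  fixes f g :: "'i \<Rightarrow> 'a::euclidean_space \<Rightarrow> real"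
  assumes I: "finite I" and V: "\<And>i. i \<in> I \<Longrightarrow> subspace (V i)" and k: "k > 0"
    and cont: "\<And>i. continuous_on UNIV (f i)" "\<And>i. continuous_on UNIV (g i)"
    and hom: "\<And>i c x. f i (c *\<^sub>R x) = \<bar>c\<bar> ^ k * f i x" "\<And>i c x. g i (c *\<^sub>R x) = \<bar>c\<bar> ^ k * g i x"
    and pos: "\<And>i x. i \<in> I \<Longrightarrow> x \<in> V i \<Longrightarrow> x \<noteq> 0 \<Longrightarrow> g i x > 0"
  shows "\<exists>C>0. \<forall>i\<in>I. \<forall>x\<in>V i. f i x \<le> C * g i x"
proof -
  have "\<forall>i\<in>I. \<exists>C>0. \<forall>x\<in>V i. f i x \<le> C * g i x"
    by (intro ballI homogeneous_dominated[OF V k cont hom pos])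
  then obtain C where C: "\<And>i. i \<in> I \<Longrightarrow> C i > 0" "\<And>i x. i \<in> I \<Longrightarrow> x \<in> V i \<Longrightarrow> f i x \<le> C i * g i x"
    by metis
  define D where "D = 1 + (\<Sum>i\<in>I. C i)"
  have "D > 0" using sum_nonneg[of I C] C(1) by (simp add: D_def add_pos_nonneg less_imp_le)
  moreover have "f i x \<le> D * g i x" if "i \<in> I" "x \<in> V i" for i x
  proof -
    have "C i \<le> D"
      using member_le_sum[OF that(1), of C] I C(1) by (simp add: D_def less_imp_le)
    moreover have "g i 0 = 0" using hom(2)[of i 0 0] k by (simp add: zero_power)
    hence "g i x \<ge> 0" using pos[OF that] by (cases "x = 0") (simp_all add: less_imp_le)
    ultimately show ?thesis
      using C(2)[OF that] mult_right_mono by fastforce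
  qed
  ultimately show ?thesis by blast
qed

lemma nonincreasing_finite_exceptions:
  fixes f :: "real \<Rightarrow> real"
  assumes ab: "a \<le> b" and cont: "continuous_on {a..b} f" and S: "finite S"
    and der: "\<And>t. t \<in> {a<..<b} - S \<Longrightarrow> \<exists>D\<le>0. (f has_real_derivative D) (at t)"
  shows "f b \<le> f a"
proof -
  obtain D where D: "\<And>t. t \<in> {a<..<b} - S \<Longrightarrow> D t \<le> 0 \<and> (f has_real_derivative D t) (at t)"
    using der by metis
  define f' where "f' t = (if t \<in> {a<..<b} - S then D t else 0)" for t
  have "(f' has_integral (f b - f a)) {a..b}"
  proof (rule fundamental_theorem_of_calculus_interior_strong[OF S ab _ cont])
    show "(f has_vector_derivative f' t) (at t)" if "t \<in> {a<..<b} - S" for t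
      using D[OF that] that by (simp add: f'_def has_real_derivative_iff_has_vector_derivative)
  qed
  moreover have "((\<lambda>_. 0::real) has_integral 0) {a..b}" by simp
  moreover have "f' t \<le> 0" for t using D[of t] by (simp add: f'_def)
  ultimately have "f b - f a \<le> 0" by (rule has_integral_le)
  thus ?thesis by simp
qed

lemma exp_decay_finite_exceptions:
  fixes f :: "real \<Rightarrow> real"
  assumes ab: "a \<le> b" and cont: "continuous_on {a..b} f" and S: "finite S"
    and der: "\<And>t. t \<in> {a<..<b} - S \<Longrightarrow> \<exists>D\<le>- c * f t. (f has_real_derivative D) (at t)"
  shows "f b \<le> exp (- c * (b - a)) * f a"
proof -
  define \<phi> where "\<phi> t = exp (c * (t - a)) * f t" for t
  have "\<phi> b \<le> \<phi> a"
  proof (rule nonincreasing_finite_exceptions[OF ab _ S])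
    show "continuous_on {a..b} \<phi>"
      unfolding \<phi>_def by (intro continuous_intros cont)
    fix t assume "t \<in> {a<..<b} - S"
    then obtain D where D: "D \<le> - c * f t" "(f has_real_derivative D) (at t)" using der by blast
    have "(\<phi> has_real_derivative exp (c * (t - a)) * (c * f t + D)) (at t)"
      unfolding \<phi>_def by (rule derivative_eq_intros D refl | simp add: algebra_simps)+
    moreover have "exp (c * (t - a)) * (c * f t + D) \<le> 0"
      using D(1) by (intro mult_nonneg_nonpos) simp_all
    ultimately show "\<exists>D\<le>0. (\<phi> has_real_derivative D) (at t)" by blast
  qed
  have "f b = exp (- c * (b - a)) * \<phi> b"
    by (simp add: \<phi>_def flip: mult.assoc exp_add)
  also have "\<dots> \<le> exp (- c * (b - a)) * f a"
    using \<open>\<phi> b \<le> \<phi> a\<close> by (intro mult_left_mono) (simp_all add: \<phi>_def)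
  finally show ?thesis .
qed

lemma has_vector_derivative_in_subspace:
  fixes f :: "real \<Rightarrow> 'a::euclidean_space"
  assumes V: "subspace V" and ev: "\<forall>\<^sub>F u in nhds t. f u \<in> V" and der: "(f has_vector_derivative w) (at t)"
  shows "w \<in> V"
proof -
  have "y \<bullet> w = 0" if "y \<in> V\<^sup>\<bottom>" for y
  proof -
    have "((\<lambda>u. y \<bullet> f u) has_real_derivative y \<bullet> w) (at t)"
      unfolding has_real_derivative_iff_has_vector_derivative
      by (rule bounded_linear.has_vector_derivative[OF bounded_linear_inner_right der])
    moreover have "\<forall>\<^sub>F u in nhds t. y \<bullet> f u = 0"
      using ev
      by eventually_elim (use that in \<open>simp add: orthogonal_comp_def orthogonal_def inner_commute[of y]\<close>)
    ultimately have "((\<lambda>_. 0) has_real_derivative y \<bullet> w) (at t)"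
      by (subst DERIV_cong_ev[OF refl _ refl, symmetric])
    thus ?thesis by (rule DERIV_unique) simp
  qed
  hence "w \<in> V\<^sup>\<bottom>\<^sup>\<bottom>" by (simp add: orthogonal_comp_def orthogonal_def)
  thus ?thesis by (simp add: orthogonal_comp_self[OF V])
qed

section \<open>Switching signals\<close>

lemma isCont_discrete_iff: "isCont f t \<longleftrightarrow> (\<forall>\<^sub>F u in nhds t. f u = f t)"
  for f :: "'a::t2_space \<Rightarrow> 'b::discrete_topology"
  by (simp add: isCont_def tendsto_discrete eventually_nhds_conv_at)

text \<open>The value of a switching signal at a switching instant is irrelevant to the dynamics;
  the active mode is read off to the right.\<close>

definition right_mode :: "(real \<Rightarrow> nat) \<Rightarrow> real \<Rightarrow> nat" where
  "right_mode \<sigma> t = Lim (at_right t) \<sigma>"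

lemma right_mode_eqI: "(\<sigma> \<longlongrightarrow> j) (at_right t) \<Longrightarrow> right_mode \<sigma> t = j"
  unfolding right_mode_def by (rule tendsto_Lim) simp_all

lemma right_mode_open:
  assumes "open S" "t \<in> S" "\<And>u. u \<in> S \<Longrightarrow> \<sigma> u = i"
  shows "right_mode \<sigma> t = i"
proof (rule right_mode_eqI, rule tendsto_eventually)
  have "\<forall>\<^sub>F u in nhds t. u \<in> S" using assms(1,2) by (rule eventually_nhds_in_open)
  hence "\<forall>\<^sub>F u in at_right t. u \<in> S" by (auto simp: eventually_at_filter elim: eventually_mono)
  thus "\<forall>\<^sub>F u in at_right t. \<sigma> u = i" by eventually_elim (rule assms(3))
qed

lemma switching_signal_eventually_isCont:
  assumes "switching_signal \<sigma>"
  shows "\<forall>\<^sub>F u in at_right t. isCont \<sigma> u"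
proof -
  define D where "D = {u \<in> {t..t+1}. \<not> isCont \<sigma> u} - {t}"
  have "open (- D)"
    using assms by (intro open_Compl finite_imp_closed) (simp add: D_def switching_signal_def)
  moreover have "t \<in> - D" by (simp add: D_def)
  ultimately have "\<forall>\<^sub>F u in nhds t. u \<in> - D" by (rule eventually_nhds_in_open)
  hence "\<forall>\<^sub>F u in at_right t. u \<in> - D" by (auto simp: eventually_at_filter elim: eventually_mono)
  moreover have "\<forall>\<^sub>F u in at_right t. u \<in> {t<..<t+1}"
    by (rule eventually_at_right_real) simp
  ultimately show ?thesis by eventually_elim (auto simp: D_def)
qed

lemma switching_signal_right_mode:
  assumes "switching_signal \<sigma>"
  shows "\<exists>b>t. \<forall>u\<in>{t<..<b}. isCont \<sigma> u \<and> \<sigma> u = right_mode \<sigma> t"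
proof -
  obtain b where b: "b > t" "\<And>u. u \<in> {t<..<b} \<Longrightarrow> isCont \<sigma> u"
    using switching_signal_eventually_isCont[OF assms, of t] by (auto simp: eventually_at_right_field)
  have "\<sigma> constant_on {t<..<b}"
  proof (rule locally_constant_imp_constant)
    fix a assume a: "a \<in> {t<..<b}"
    then obtain T where T: "open T" "a \<in> T" "\<forall>u\<in>T. \<sigma> u = \<sigma> a"
      using b(2) unfolding isCont_discrete_iff eventually_nhds by blast
    thus "\<exists>T. openin (top_of_set {t<..<b}) T \<and> a \<in> T \<and> (\<forall>u\<in>T. \<sigma> u = \<sigma> a)"
      using openin_open_Int[OF T(1), of "{t<..<b}"] T(2,3) a by blast
  qed simp
  then obtain j where j: "\<And>u. u \<in> {t<..<b} \<Longrightarrow> \<sigma> u = j" by (auto simp: constant_on_def)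
  have "\<forall>\<^sub>F u in at_right t. \<sigma> u = j"
    unfolding eventually_at_right_field using b(1) j by auto
  hence "right_mode \<sigma> t = j" by (intro right_mode_eqI tendsto_eventually)
  thus ?thesis using b j by auto
qed

lemma right_mode_range:
  assumes "switching_signal \<sigma>"
  shows "right_mode \<sigma> t \<in> {1, 2}"
proof -
  obtain b where b: "b > t" "\<forall>u\<in>{t<..<b}. \<sigma> u = right_mode \<sigma> t"
    using switching_signal_right_mode[OF assms] by blast
  obtain u where "u \<in> {t<..<b}" using b(1) dense by auto
  thus ?thesis using b(2) assms unfolding switching_signal_def by metis
qed

section \<open>Decay of switched solutions\<close>

locale switched_descriptor =
  fixes E A :: "nat \<Rightarrow> real^'n^'n" and X Y :: "nat \<Rightarrow> real^'r^'n"
    and Et :: "nat \<Rightarrow> real^'r^'r" and P :: "real^'r^'r"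
  assumes descriptor: "\<And>i. i \<in> {1, 2} \<Longrightarrow> descriptor (E i) (A i) (X i) (Y i) (Et i)"
    and kernel_inter_range: "\<And>i w. i \<in> {1, 2} \<Longrightarrow> w \<in> range ((*v) (Et i)) \<Longrightarrow> Et i *v w = 0 \<Longrightarrow> w = 0"
    and P: "pos_def P"
    and dissip: "\<And>i. i \<in> {1, 2} \<Longrightarrow> dissipative P (Et i)"
begin

abbreviation F :: "nat \<Rightarrow> real^'r^'n" where
  "F i \<equiv> descriptor.state_mat (A i) (X i)"

lemma P_sym: "transpose P = P"
  using P by (simp add: pos_def_def)

definition energy :: "real^'r \<Rightarrow> real" where
  "energy y = y \<bullet> (P *v y)"

lemma energy_pos: "y \<noteq> 0 \<Longrightarrow> energy y > 0"
  using P by (simp add: energy_def pos_def_def)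

lemma energy_scaleR: "energy (c *\<^sub>R y) = \<bar>c\<bar>\<^sup>2 * energy y"
  by (simp add: energy_def matrix_vector_mult_scaleR power2_eq_square)

lemma continuous_on_energy [continuous_intros]:
  "continuous_on S f \<Longrightarrow> continuous_on S (\<lambda>x. energy (f x))"
  unfolding energy_def by (intro continuous_intros)

lemma norm_le_energy: "\<exists>C>0. \<forall>y. (norm y)\<^sup>2 \<le> C * energy y"
proof -
  have "\<exists>C>0. \<forall>y\<in>UNIV. (norm y)\<^sup>2 \<le> C * energy y"
    by (intro homogeneous_dominated[where k = 2])
      (auto intro!: continuous_intros energy_pos simp: energy_scaleR power_mult_distrib)
  thus ?thesis by simp
qed

lemma energy_le_norm: "\<exists>C>0. \<forall>y. energy y \<le> C * (norm y)\<^sup>2"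
proof -
  have "\<exists>C>0. \<forall>y\<in>UNIV. energy y \<le> C * (norm y)\<^sup>2"
    by (intro homogeneous_dominated[where k = 2])
      (auto intro!: continuous_intros simp: energy_scaleR power_mult_distrib)
  thus ?thesis by simp
qed

lemma mode_subspace: "subspace (range ((*v) (Et i)))"
  by (intro linear_subspace_image) auto

lemma mode_dissipation_rate:
  "\<exists>\<alpha>>0. \<forall>i\<in>{1,2}. \<forall>w\<in>range ((*v) (Et i)). 2 * (w \<bullet> (P *v (Et i *v w))) \<le> - \<alpha> * energy (Et i *v w)"
proof -
  have "\<exists>C>0. \<forall>i\<in>{1,2}. \<forall>w\<in>range ((*v) (Et i)). energy (Et i *v w) \<le> C * (- 2 * (w \<bullet> (P *v (Et i *v w))))"
  proof (rule homogeneous_dominated_uniform[where k = 2])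
    show "- 2 * (w \<bullet> (P *v (Et i *v w))) > 0" if "i \<in> {1,2}" "w \<in> range ((*v) (Et i))" "w \<noteq> 0" for i w
      using dissip[OF that(1)] kernel_inter_range[OF that(1,2)] that(3) by (auto simp: dissipative_def)
  qed (auto intro!: mode_subspace continuous_intros
      simp: energy_scaleR matrix_vector_mult_scaleR power2_eq_square)
  then obtain C where C: "C > 0"
    "\<And>i w. i \<in> {1,2} \<Longrightarrow> w \<in> range ((*v) (Et i)) \<Longrightarrow> energy (Et i *v w) \<le> C * (- 2 * (w \<bullet> (P *v (Et i *v w))))"
    by blast
  have "2 * (w \<bullet> (P *v (Et i *v w))) \<le> - (1 / C) * energy (Et i *v w)"
    if "i \<in> {1,2}" "w \<in> range ((*v) (Et i))" for i w
    using C(2)[OF that] C(1) by (simp add: field_simps)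
  thus ?thesis using C(1) by (intro exI[of _ "1 / C"]) simp
qed

lemma mode_state_bound:
  "\<exists>C>0. \<forall>i\<in>{1,2}. \<forall>w\<in>range ((*v) (Et i)). norm (F i *v w) \<le> C * norm (Et i *v w)"
proof (rule homogeneous_dominated_uniform[where k = 1])
  show "norm (Et i *v w) > 0" if "i \<in> {1,2}" "w \<in> range ((*v) (Et i))" "w \<noteq> 0" for i w
    using kernel_inter_range[OF that(1,2)] that(3) by auto
qed (auto intro!: mode_subspace continuous_intros simp: matrix_vector_mult_scaleR)

lemma output_bound: "\<exists>C>0. \<forall>i\<in>{1,2}. \<forall>x. norm (transpose (Y i) *v x) \<le> C * norm x"
proof -
  have "\<exists>C>0. \<forall>i\<in>{1,2}. \<forall>x\<in>UNIV. norm (transpose (Y i) *v x) \<le> C * norm x"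
    by (rule homogeneous_dominated_uniform[where k = 1])
      (auto intro!: continuous_intros simp: matrix_vector_mult_scaleR)
  thus ?thesis by simp
qed

definition reduced_state :: "(real \<Rightarrow> nat) \<Rightarrow> (real \<Rightarrow> real^'n) \<Rightarrow> real \<Rightarrow> real^'r" where
  "reduced_state \<sigma> x t = transpose (Y (right_mode \<sigma> t)) *v x t"

context
  fixes \<sigma> :: "real \<Rightarrow> nat" and t0 :: real and x :: "real \<Rightarrow> real^'n"
  assumes sig: "switching_signal \<sigma>" and sol: "switched_solution E A Y \<sigma> t0 x"
begin

lemma solution_flow:
  assumes "t > t0" "isCont \<sigma> t"
  shows "\<exists>v. (x has_vector_derivative v) (at t) \<and> E (\<sigma> t) *v v = A (\<sigma> t) *v x t"
  using sol assms unfolding switched_solution_def by (elim conjE) blast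

lemma solution_jump:
  assumes "t > t0" "\<not> isCont \<sigma> t"
  obtains xm i j where "(x \<longlongrightarrow> xm) (at_left t)" "(x \<longlongrightarrow> x t) (at_right t)"
    "(\<sigma> \<longlongrightarrow> i) (at_left t)" "(\<sigma> \<longlongrightarrow> j) (at_right t)"
    "transpose (Y j) *v x t = transpose (Y i) *v xm"
  using sol assms unfolding switched_solution_def by (elim conjE) blast

lemma reduced_state_derivative:
  assumes t: "t > t0" "isCont \<sigma> t"
  obtains i w where "i \<in> {1,2}" "w \<in> range ((*v) (Et i))"
    "(reduced_state \<sigma> x has_vector_derivative w) (at t)"
    "x t = F i *v w" "reduced_state \<sigma> x t = Et i *v w"
proof -
  define i where "i = \<sigma> t"
  have i12: "i \<in> {1, 2}" using sig by (simp add: i_def switching_signal_def)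
  interpret descriptor "E i" "A i" "X i" "Y i" "Et i" using i12 by (rule descriptor)
  obtain S0 where S0: "open S0" "t \<in> S0" "\<And>u. u \<in> S0 \<Longrightarrow> \<sigma> u = i"
    using t(2) unfolding isCont_discrete_iff eventually_nhds i_def by blast
  define S where "S = S0 \<inter> {t0<..}"
  have S: "open S" "t \<in> S" "\<And>u. u \<in> S \<Longrightarrow> \<sigma> u = i" "\<And>u. u \<in> S \<Longrightarrow> u > t0"
    using S0 t by (auto simp: S_def)
  have state_S: "reduced_state \<sigma> x u = transpose (Y i) *v x u" if "u \<in> S" for u
    using right_mode_open[OF S(1) that S(3)] by (simp add: reduced_state_def)
  have flow: "\<exists>v. (x has_vector_derivative v) (at u) \<and> E i *v v = A i *v x u" if "u \<in> S" for u
  proof -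
    have "isCont \<sigma> u"
      unfolding isCont_discrete_iff eventually_nhds using S(1,3) that by metis
    thus ?thesis using solution_flow[of u] S(3,4)[OF that] by simp
  qed
  obtain v where v: "(x has_vector_derivative v) (at t)" "E i *v v = A i *v x t" using flow[OF S(2)] by blast
  define w where "w = transpose (Y i) *v v"
  have "((\<lambda>u. transpose (Y i) *v x u) has_vector_derivative w) (at t)"
    unfolding w_def
    by (rule bounded_linear.has_vector_derivative[OF matrix_vector_mul_bounded_linear v(1)])
  hence der: "(reduced_state \<sigma> x has_vector_derivative w) (at t)"
    by (rule has_vector_derivative_transform_within_open[OF _ S(1,2)]) (simp add: state_S)
  have "reduced_state \<sigma> x u \<in> range ((*v) (Et i))" if "u \<in> S" for u
    using flow[OF that] descriptor_eq_reduced(2) state_S[OF that] by auto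
  hence "\<forall>\<^sub>F u in nhds t. reduced_state \<sigma> x u \<in> range ((*v) (Et i))"
    using eventually_nhds_in_open[OF S(1,2)] by (auto elim: eventually_mono)
  hence "w \<in> range ((*v) (Et i))"
    using has_vector_derivative_in_subspace[OF mode_subspace _ der] by blast
  thus ?thesis
    using that[OF i12 _ der] descriptor_eq_reduced[OF v(2)] state_S[OF S(2)] by (simp add: w_def)
qed

lemma solution_right_continuous:
  assumes "t \<ge> t0"
  shows "(x \<longlongrightarrow> x t) (at_right t)"
proof -
  consider (initial) "t = t0" | (regular) "t > t0" "isCont \<sigma> t" | (switch) "t > t0" "\<not> isCont \<sigma> t"
    using assms by linarith
  thus ?thesis
  proof cases
    case initial
    thus ?thesis using sol by (simp add: switched_solution_def)
  next
    case regular
    then obtain v where "(x has_vector_derivative v) (at t)" using solution_flow by blast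
    hence "isCont x t" by (rule has_vector_derivative_continuous)
    thus ?thesis unfolding isCont_def by (rule tendsto_within_subset) simp
  next
    case switch
    thus ?thesis by (rule solution_jump)
  qed
qed

lemma reduced_state_right_continuous:
  assumes "t \<ge> t0"
  shows "(reduced_state \<sigma> x \<longlongrightarrow> reduced_state \<sigma> x t) (at_right t)"
proof -
  obtain b where b: "b > t" "\<forall>u\<in>{t<..<b}. \<sigma> u = right_mode \<sigma> t"
    using switching_signal_right_mode[OF sig] by blast
  have mode: "right_mode \<sigma> u = right_mode \<sigma> t" if "u \<in> {t<..<b}" for u
    by (rule right_mode_open[of "{t<..<b}"]) (use that b in auto)
  have "((\<lambda>u. transpose (Y (right_mode \<sigma> t)) *v x u) \<longlongrightarrow> reduced_state \<sigma> x t) (at_right t)"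
    unfolding reduced_state_def
    by (rule bounded_linear.tendsto[OF matrix_vector_mul_bounded_linear solution_right_continuous[OF assms]])
  moreover have "\<forall>\<^sub>F u in at_right t. transpose (Y (right_mode \<sigma> t)) *v x u = reduced_state \<sigma> x u"
    unfolding eventually_at_right_field using b(1) mode by (intro exI[of _ b]) (simp add: reduced_state_def)
  ultimately show ?thesis by (rule Lim_transform_eventually)
qed

lemma reduced_state_left_continuous:
  assumes t: "t > t0"
  shows "(reduced_state \<sigma> x \<longlongrightarrow> reduced_state \<sigma> x t) (at_left t)"
proof (cases "isCont \<sigma> t")
  case True
  obtain w where "(reduced_state \<sigma> x has_vector_derivative w) (at t)"
    using reduced_state_derivative[OF t True] by blast
  hence "isCont (reduced_state \<sigma> x) t" by (rule has_vector_derivative_continuous)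
  thus ?thesis unfolding isCont_def by (rule tendsto_within_subset) simp
next
  case False
  obtain xm i j where xm: "(x \<longlongrightarrow> xm) (at_left t)" "transpose (Y j) *v x t = transpose (Y i) *v xm"
    and i: "(\<sigma> \<longlongrightarrow> i) (at_left t)" and j: "(\<sigma> \<longlongrightarrow> j) (at_right t)"
    by (rule solution_jump[OF t False])
  obtain b where b: "b < t" "\<And>u. u > b \<Longrightarrow> u < t \<Longrightarrow> \<sigma> u = i"
    using i unfolding tendsto_discrete eventually_at_left_field by blast
  have mode: "right_mode \<sigma> u = i" if "u > b" "u < t" for u
    by (rule right_mode_open[of "{b<..<t}"]) (use that b in auto)
  have "((\<lambda>u. transpose (Y i) *v x u) \<longlongrightarrow> reduced_state \<sigma> x t) (at_left t)"
    unfolding reduced_state_def right_mode_eqI[OF j] xm(2)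
    by (rule bounded_linear.tendsto[OF matrix_vector_mul_bounded_linear xm(1)])
  moreover have "\<forall>\<^sub>F u in at_left t. transpose (Y i) *v x u = reduced_state \<sigma> x u"
    unfolding eventually_at_left_field using b(1) mode by (intro exI[of _ b]) (simp add: reduced_state_def)
  ultimately show ?thesis by (rule Lim_transform_eventually)
qed

lemma reduced_state_continuous: "continuous_on {t0..T} (reduced_state \<sigma> x)"
  unfolding continuous_on_def
proof
  fix t assume t: "t \<in> {t0..T}"
  show "(reduced_state \<sigma> x \<longlongrightarrow> reduced_state \<sigma> x t) (at t within {t0..T})"
  proof (cases "t = t0")
    case True
    have "(reduced_state \<sigma> x \<longlongrightarrow> reduced_state \<sigma> x t) (at t within {t..})"
      using reduced_state_right_continuous[of t] t by (simp add: at_within_Ici_at_right)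
    thus ?thesis by (rule tendsto_within_subset) (use True in auto)
  next
    case False
    hence "(reduced_state \<sigma> x \<longlongrightarrow> reduced_state \<sigma> x t) (at t)"
      using reduced_state_left_continuous[of t] reduced_state_right_continuous[of t] t
      by (simp add: filterlim_at_split)
    thus ?thesis by (rule tendsto_within_subset) simp
  qed
qed

lemma energy_decay:
  assumes \<alpha>: "\<And>i w. i \<in> {1,2} \<Longrightarrow> w \<in> range ((*v) (Et i)) \<Longrightarrow>
      2 * (w \<bullet> (P *v (Et i *v w))) \<le> - \<alpha> * energy (Et i *v w)"
    and t: "t \<ge> t0"
  shows "energy (reduced_state \<sigma> x t) \<le> exp (- \<alpha> * (t - t0)) * energy (reduced_state \<sigma> x t0)"
proof (rule exp_decay_finite_exceptions[OF t])
  let ?y = "reduced_state \<sigma> x"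
  show "continuous_on {t0..t} (\<lambda>t. energy (?y t))"
    by (intro continuous_intros reduced_state_continuous)
  show "finite {u \<in> {t0..t}. \<not> isCont \<sigma> u}" using sig by (simp add: switching_signal_def)
  fix u assume "u \<in> {t0<..<t} - {u \<in> {t0..t}. \<not> isCont \<sigma> u}"
  hence "u > t0" "isCont \<sigma> u" by auto
  then obtain i w where i: "i \<in> {1,2}" and w: "w \<in> range ((*v) (Et i))"
    and der: "(?y has_vector_derivative w) (at u)" and yu: "?y u = Et i *v w"
    by (rule reduced_state_derivative)
  have "((\<lambda>t. P *v ?y t) has_vector_derivative P *v w) (at u)"
    by (rule bounded_linear.has_vector_derivative[OF matrix_vector_mul_bounded_linear der])
  with der have "((\<lambda>t. energy (?y t)) has_vector_derivative ?y u \<bullet> (P *v w) + w \<bullet> (P *v ?y u)) (at u)"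
    unfolding energy_def by (rule bounded_bilinear.has_vector_derivative[OF bounded_bilinear_inner])
  moreover have "?y u \<bullet> (P *v w) = w \<bullet> (P *v ?y u)"
    by (metis inner_commute inner_mult_sym[OF P_sym])
  ultimately have "((\<lambda>t. energy (?y t)) has_real_derivative 2 * (w \<bullet> (P *v ?y u))) (at u)"
    by (simp add: has_real_derivative_iff_has_vector_derivative)
  moreover have "2 * (w \<bullet> (P *v ?y u)) \<le> - \<alpha> * energy (?y u)"
    unfolding yu using i w by (rule \<alpha>)
  ultimately show "\<exists>D\<le>- \<alpha> * energy (?y u). ((\<lambda>t. energy (?y t)) has_real_derivative D) (at u)"
    by blast
qed

lemma solution_norm_le_reduced_state:
  assumes C: "\<And>i w. i \<in> {1,2} \<Longrightarrow> w \<in> range ((*v) (Et i)) \<Longrightarrow> norm (F i *v w) \<le> C * norm (Et i *v w)"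
    and t: "t \<ge> t0"
  shows "norm (x t) \<le> C * norm (reduced_state \<sigma> x t)"
proof (rule tendsto_le)
  show "((\<lambda>u. norm (x u)) \<longlongrightarrow> norm (x t)) (at_right t)"
    by (intro tendsto_intros solution_right_continuous t)
  show "((\<lambda>u. C * norm (reduced_state \<sigma> x u)) \<longlongrightarrow> C * norm (reduced_state \<sigma> x t)) (at_right t)"
    by (intro tendsto_intros reduced_state_right_continuous t)
  have flow: "norm (x u) \<le> C * norm (reduced_state \<sigma> x u)" if "u > t0" "isCont \<sigma> u" for u
    using reduced_state_derivative[OF that] C by metis
  have "\<forall>\<^sub>F u in at_right t. u > t0"
    using t eventually_at_right_less[of t] by (auto elim: eventually_mono)
  thus "\<forall>\<^sub>F u in at_right t. norm (x u) \<le> C * norm (reduced_state \<sigma> x u)"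
    using switching_signal_eventually_isCont[OF sig, of t] by eventually_elim (rule flow)
qed simp

end

lemma reduced_state_decay:
  "\<exists>\<alpha>>0. \<exists>C>0. \<forall>\<sigma> t0 x. switching_signal \<sigma> \<and> switched_solution E A Y \<sigma> t0 x \<longrightarrow>
     (\<forall>t\<ge>t0. norm (reduced_state \<sigma> x t) \<le> C * exp (- \<alpha> * (t - t0)) * norm (reduced_state \<sigma> x t0))"
proof -
  obtain \<alpha> where \<alpha>: "\<alpha> > 0"
    "\<And>i w. i \<in> {1,2} \<Longrightarrow> w \<in> range ((*v) (Et i)) \<Longrightarrow> 2 * (w \<bullet> (P *v (Et i *v w))) \<le> - \<alpha> * energy (Et i *v w)"
    using mode_dissipation_rate by blast
  obtain m where m: "m > 0" "\<And>y. (norm y)\<^sup>2 \<le> m * energy y" using norm_le_energy by blast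
  obtain K where K: "K > 0" "\<And>y. energy y \<le> K * (norm y)\<^sup>2" using energy_le_norm by blast
  have "norm (reduced_state \<sigma> x t) \<le> sqrt (m * K) * exp (- (\<alpha> / 2) * (t - t0)) * norm (reduced_state \<sigma> x t0)"
    if "switching_signal \<sigma>" "switched_solution E A Y \<sigma> t0 x" "t \<ge> t0" for \<sigma> t0 x t
  proof (rule power2_le_imp_le)
    let ?y = "reduced_state \<sigma> x"
    have "(norm (?y t))\<^sup>2 \<le> m * energy (?y t)" by (rule m)
    also have "\<dots> \<le> m * (exp (- \<alpha> * (t - t0)) * (K * (norm (?y t0))\<^sup>2))"
      using m(1) by (intro mult_left_mono order.trans[OF energy_decay[OF that(1,2) \<alpha>(2) that(3)]] K(2))
        simp_all
    also have "exp (- \<alpha> * (t - t0)) = (exp (- (\<alpha> / 2) * (t - t0)))\<^sup>2"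
      by (simp add: field_simps flip: exp_double)
    finally show "(norm (?y t))\<^sup>2 \<le> (sqrt (m * K) * exp (- (\<alpha> / 2) * (t - t0)) * norm (?y t0))\<^sup>2"
      using m(1) K(1) by (simp add: power_mult_distrib mult_ac)
  qed (use m(1) K(1) in simp)
  thus ?thesis
    using \<alpha>(1) m(1) K(1) by (intro exI[of _ "\<alpha> / 2"] exI[of _ "sqrt (m * K)"] conjI) simp_all
qed

lemma switched_descriptor_GUES: "GUES E A Y"
proof -
  obtain \<alpha> C where \<alpha>: "\<alpha> > 0" and C: "C > 0" and decay: "\<And>\<sigma> t0 x t. switching_signal \<sigma> \<Longrightarrow>
      switched_solution E A Y \<sigma> t0 x \<Longrightarrow> t \<ge> t0 \<Longrightarrow>
      norm (reduced_state \<sigma> x t) \<le> C * exp (- \<alpha> * (t - t0)) * norm (reduced_state \<sigma> x t0)"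
    using reduced_state_decay by blast
  obtain D where D: "D > 0"
    "\<And>i w. i \<in> {1,2} \<Longrightarrow> w \<in> range ((*v) (Et i)) \<Longrightarrow> norm (F i *v w) \<le> D * norm (Et i *v w)"
    using mode_state_bound by blast
  obtain L where L: "L > 0" "\<And>i x. i \<in> {1,2} \<Longrightarrow> norm (transpose (Y i) *v x) \<le> L * norm x"
    using output_bound by blast
  have "norm (x t) \<le> (D * C * L) * exp (- \<alpha> * (t - t0)) * norm (x t0)"
    if sig: "switching_signal \<sigma>" and sol: "switched_solution E A Y \<sigma> t0 x" and t: "t \<ge> t0" for \<sigma> t0 x t
  proof -
    have "norm (x t) \<le> D * norm (reduced_state \<sigma> x t)"
      by (rule solution_norm_le_reduced_state[OF sig sol D(2) t])
    also have "\<dots> \<le> D * (C * exp (- \<alpha> * (t - t0)) * norm (reduced_state \<sigma> x t0))"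
      using D(1) decay[OF sig sol t] by (intro mult_left_mono) simp_all
    also have "norm (reduced_state \<sigma> x t0) \<le> L * norm (x t0)"
      unfolding reduced_state_def using right_mode_range[OF sig] by (rule L(2))
    finally show ?thesis using C D(1) by (simp add: mult_ac)
  qed
  moreover have "D * C * L > 0" using C D(1) L(1) by simp
  ultimately show ?thesis unfolding GUES_def using \<alpha> by blast
qed

end

theorem theorem5:
  fixes E A :: "nat \<Rightarrow> real^'n^'n" and X Y :: "nat \<Rightarrow> real^'r^'n"
    and Et :: "nat \<Rightarrow> real^'r^'r" and g h :: "real^'r"
  assumes inv: "\<And>i. i \<in> {1, 2} \<Longrightarrow> invertible (A i)"
    and frd: "\<And>i. i \<in> {1, 2} \<Longrightarrow> full_rank_decomp (E i) (X i) (Y i)"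
    and Et_def: "\<And>i. i \<in> {1, 2} \<Longrightarrow> Et i = transpose (Y i) ** matrix_inv (A i) ** X i"
    and stab: "desc_stable (E 1) (A 1)" "desc_stable (E 2) (A 2)"
    and idx: "desc_index (E 1) (A 1) = 1" "desc_index (E 2) (A 2) = 2"
    and rank1: "Et 2 = Et 1 - outer g h"
    and ctrb: "controllable (Et 1) g"
    and obsv: "observable h (Et 1)"
    and noneg: "\<forall>s::real. s < 0 \<longrightarrow> poly (char_poly (Et 1 ** Et 2)) s \<noteq> 0"
    and zero1: "order 0 (char_poly (Et 1 ** Et 2)) = 1"
  shows "GUES E A Y"
proof -
  have desc: "descriptor (E i) (A i) (X i) (Y i) (Et i)" if "i \<in> {1, 2}" for i
    using that by (intro descriptor.intro inv frd Et_def)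
  interpret mode1: descriptor "E 1" "A 1" "X 1" "Y 1" "Et 1" by (rule desc) simp
  interpret mode2: descriptor "E 2" "A 2" "X 2" "Y 2" "Et 2" by (rule desc) simp
  note mode1_ker = mode1.index_one_kernel_trivial[OF idx(1)]
  have "hurwitz_mat (Et 1)"
    using stab(1) mode1_ker by (rule mode1.stable_imp_hurwitz_mat)
  then obtain P where P: "pos_def P" "dissipative P (Et 1)" "dissipative P (Et 2)"
    using common_lyapunov_matrix_exists[OF _ ctrb rank1] noneg zero1 by blast
  have "switched_descriptor E A X Y Et P"
  proof (rule switched_descriptor.intro)
    show "w = 0" if "i \<in> {1, 2}" "w \<in> range ((*v) (Et i))" "Et i *v w = 0" for i w
      using that mode1_ker mode2.index_two_kernel_inter_range_trivial[OF idx(2)] by blast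
  qed (use desc P in auto)
  thus ?thesis by (rule switched_descriptor.switched_descriptor_GUES)
qed

end
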